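(* Let $\kappa>0$, let $\mathcal U\subset\mathbb R^2$ be an exterior region, and let $L=L_{x_0,\theta}$ be a straight line with $x_0\in\mathbb R^2$, $\theta\in\mathbb S^1$, such that $L\subset\mathcal U$. Then every radiation solution $\psi$ of the Helmholtz equation $\Delta\psi+\kappa^2\psi=0$ in $\mathcal U$ is uniquely determined in the entire region $\mathcal U$ by $\mathrm{Im}(\psi)$ on $L$. That is, if $\psi_1,\psi_2$ are two radiation solutions in $\mathcal U$ (for the same $\kappa$) with $\mathrm{Im}(\psi_1)=\mathrm{Im}(\psi_2)$ on $L$, then $\psi_1=\psi_2$ in $\mathcal U$.
   Context: An exterior region $\mathcal U$ is an open unbounded connected set in $\mathbb R^2$ consisting of all points outside a closed bounded regular curve $S$. A radiation solution in $\mathcal U$ (for fixed $\kappa>0$) is a complex-valued function $\psi$ of class $C^2$ on $\mathcal U$ satisfying $\Delta\psi(x)+\kappa^2\psi(x)=0$ for $x\in\mathcal U$ and the Sommerfeld radiation condition $\sqrt{|x|}\left(\frac{\partial}{\partial|x|}-i\kappa\right)\psi(x)\to0$ as $|x|\to+\infty$, uniformly in $x/|x|$. For $x_0\in\mathbb R^2$ and $\theta\in\mathbb S^1$ (unit circle): $L_{x_0,\theta}=\{x_0+s\theta:\ -\infty<s<+\infty\}$. *)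

theory Defs
  imports "HOL-Analysis.Analysis"
begin

definition regular_arc_on :: "real set \<Rightarrow> (real \<Rightarrow> real^2) \<Rightarrow> bool" where
  "regular_arc_on I g \<longleftrightarrow>
     (\<exists>g'. continuous_on I g' \<and>
           (\<forall>t\<in>I. (g has_vector_derivative g' t) (at t within I) \<and> g' t \<noteq> 0))"

text \<open>Corners are allowed at finitely many parameters, as in the classical potential-theoretic
  notion of a regular curve; smooth regular closed curves are the case of a single piece.
  Self-intersections are not excluded.\<close>

definition regular_closed_curve :: "(real \<Rightarrow> real^2) \<Rightarrow> bool" where
  "regular_closed_curve g \<longleftrightarrow>
     path g \<and> pathfinish g = pathstart g \<and>
     (\<exists>(n::nat) \<tau>. \<tau> 0 = 0 \<and> \<tau> n = 1 \<and>
        (\<forall>i<n. \<tau> i < \<tau> (Suc i) \<and> regular_arc_on {\<tau> i..\<tau> (Suc i)} g))"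

text \<open>The library's \<^term>\<open>outside S\<close> is the set of points lying in an unbounded component
  of the complement of \<open>S\<close>.\<close>

definition exterior_region :: "(real^2) set \<Rightarrow> bool" where
  "exterior_region U \<longleftrightarrow>
     open U \<and> \<not> bounded U \<and> connected U \<and>
     (\<exists>g. regular_closed_curve g \<and> U = outside (path_image g))"

definition partial_deriv :: "'n::finite \<Rightarrow> (real^'n \<Rightarrow> complex) \<Rightarrow> real^'n \<Rightarrow> complex" where
  "partial_deriv i f x = vector_derivative (\<lambda>t. f (x + t *\<^sub>R axis i 1)) (at 0)"

primrec Ck_on :: "nat \<Rightarrow> (real^'n::finite \<Rightarrow> complex) \<Rightarrow> (real^'n) set \<Rightarrow> bool" where
  "Ck_on 0 f U \<longleftrightarrow> continuous_on U f"
| "Ck_on (Suc k) f U \<longleftrightarrow> continuous_on U f \<and>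
     (\<forall>i. (\<forall>x\<in>U. (\<lambda>t. f (x + t *\<^sub>R axis i 1)) differentiable (at (0::real))) \<and>
          Ck_on k (partial_deriv i f) U)"

definition laplacian :: "(real^'n::finite \<Rightarrow> complex) \<Rightarrow> real^'n \<Rightarrow> complex" where
  "laplacian f x = (\<Sum>i\<in>UNIV. partial_deriv i (partial_deriv i f) x)"

text \<open>Polar coordinates \<open>x = r \<omega>\<close> with \<open>r = |x|\<close> and \<open>\<omega> = x/|x|\<close>: the inner derivative is
  \<open>\<partial>/\<partial>|x|\<close> at \<open>x\<close>, and the limit \<open>r \<rightarrow> \<infinity>\<close> is uniform over the unit circle.\<close>

definition sommerfeld :: "real \<Rightarrow> (real^2 \<Rightarrow> complex) \<Rightarrow> bool" where
  "sommerfeld \<kappa> \<psi> \<longleftrightarrow>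
     uniform_limit (sphere 0 1)
       (\<lambda>r \<omega>. of_real (sqrt r) *
          (vector_derivative (\<lambda>s. \<psi> (s *\<^sub>R \<omega>)) (at r) - \<i> * of_real \<kappa> * \<psi> (r *\<^sub>R \<omega>)))
       (\<lambda>\<omega>. 0) at_top"

text \<open>A function on \<open>U\<close> is represented by a total function whose values off \<open>U\<close> are
  irrelevant: \<open>U\<close> is open, and for an exterior region it contains all points of large norm.\<close>

definition radiation_solution :: "real \<Rightarrow> (real^2) set \<Rightarrow> (real^2 \<Rightarrow> complex) \<Rightarrow> bool" where
  "radiation_solution \<kappa> U \<psi> \<longleftrightarrow>
     Ck_on 2 \<psi> U \<and>
     (\<forall>x\<in>U. laplacian \<psi> x + of_real (\<kappa>\<^sup>2) * \<psi> x = 0) \<and>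
     sommerfeld \<kappa> \<psi>"

definition straight_line :: "real^2 \<Rightarrow> real^2 \<Rightarrow> (real^2) set" where
  "straight_line x0 \<theta> = {x0 + s *\<^sub>R \<theta> | s. s \<in> UNIV}"

end

theory Submission
  imports Defs
begin

text \<open>In coordinates where \<open>L\<close> is the real axis and \<open>S\<close> lies in the lower half plane, put
  \<open>f = \<psi>1 - \<psi>2\<close> and \<open>w(z) = f(z) + f(cnj z)\<close>. Near infinity \<open>Im w\<close> is an even solution that
  vanishes on the real axis, so it has zero Cauchy data there and vanishes identically. Hence \<open>w\<close>
  is a \<^emph>\<open>real\<close> radiating solution; the real and imaginary parts of the radiation condition then say
  that \<open>w\<close> and its radial derivative are \<open>o(1/\<surd>r)\<close>, and \<open>w = 0\<close> by Rellich's lemma. By unique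
  continuation \<open>f\<close> is odd near the real axis, so the odd extension of \<open>f\<close> from the upper half plane
  is an entire radiating solution, and it must vanish.

  Unique continuation, Rellich's lemma and the vanishing of entire radiating solutions all follow
  from the Bessel equation satisfied by the Fourier coefficients on circles.\<close>

subsection \<open>Energy estimate for the Bessel equation\<close>

text \<open>The radiation condition refers to the original origin and controls only the derivative
  along rays from there, whereas the reflection needs a center on the line. Moving the center turns
  the radial direction by O(1/r), and the radial derivative alone does not control the error; this
  is why a growth bound and an interior gradient estimate appear. A second obstacle is geometric.
  The hypothesis places only the line in the region; since the curve is connected and misses the
  line, it stays on one side, and a whole closed half plane is free of it. The symmetrized function
  exists only where a point and its mirror image both lie in the region. That set contains the axis
  and a neighbourhood of infinity but is not known to be connected, so the continuation is carried
  out in the component containing the axis. Solutions are merely C^2: every uniqueness statement is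
  reduced to energy estimates for ordinary differential equations instead of analyticity.\<close>

text \<open>If \<open>f\<close> satisfies Bessel's equation with \<open>m = n\<^sup>2\<close>, then \<open>g(x) = f(x) \<surd>x\<close> satisfies
  \<open>g'' + \<kappa>\<^sup>2 g = (m - 1/4) g / x\<^sup>2\<close>, and \<open>g'\<^sup>2 + \<kappa>\<^sup>2 g\<^sup>2\<close> is the quantity below. The factor
  \<open>1/x\<^sup>2\<close> is integrable at infinity, which bounds the energy at one point by the energy at another.\<close>

definition bessel_energy :: "real \<Rightarrow> (real \<Rightarrow> real) \<Rightarrow> (real \<Rightarrow> real) \<Rightarrow> real \<Rightarrow> real" where
  "bessel_energy \<kappa> f f1 x = x * (f1 x)\<^sup>2 + f x * f1 x + (f x)\<^sup>2 / (4 * x) + \<kappa>\<^sup>2 * x * (f x)\<^sup>2"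

text \<open>With \<open>g = f * sqrt x\<close>, the term in absolute values is
  \<open>g * g'\<close>, so this is 2 \<kappa> |g g'| \<le> g'^2 + \<kappa>^2 g^2. The proof expands
  the square of g' - c \<kappa> g for c = 1 and c = -1.\<close>

lemma bessel_energy_bound:
  assumes "0 < x"
  shows "2 * \<kappa> * \<bar>x * f x * f1 x + (f x)\<^sup>2 / 2\<bar> \<le> bessel_energy \<kappa> f f1 x"
proof -
  have *: "bessel_energy \<kappa> f f1 x - 2 * (c * \<kappa>) * (x * f x * f1 x + (f x)\<^sup>2 / 2)
      = (x * f1 x + f x / 2 - (c * \<kappa>) * x * f x)\<^sup>2 / x" if "c\<^sup>2 = 1" for c
  proof -
    have "\<kappa>\<^sup>2 = (c * \<kappa>)\<^sup>2"
      using that by (simp add: power_mult_distrib)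
    then show ?thesis
      unfolding bessel_energy_def using assms
      by (simp only:) (simp add: field_simps power2_eq_square)
  qed
  have "0 \<le> bessel_energy \<kappa> f f1 x - 2 * (c * \<kappa>) * (x * f x * f1 x + (f x)\<^sup>2 / 2)" if "c\<^sup>2 = 1" for c
    unfolding *[OF that] using assms by simp
  from this[of 1] this[of "-1"] show ?thesis
    by (simp add: abs_if algebra_simps)
qed

lemma bessel_energy_nonneg:
  assumes "0 < x" "0 \<le> \<kappa>"
  shows "0 \<le> bessel_energy \<kappa> f f1 x"
proof -
  have "0 \<le> 2 * \<kappa> * \<bar>x * f x * f1 x + (f x)\<^sup>2 / 2\<bar>"
    using assms by simp
  then show ?thesis
    using bessel_energy_bound[OF assms(1)] order_trans by blast
qed

lemma bessel_energy_eq_0: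
  assumes "0 < x" "0 < \<kappa>" "bessel_energy \<kappa> f f1 x = 0"
  shows "f x = 0"
proof -
  have "bessel_energy \<kappa> f f1 x = (x * f1 x + f x / 2)\<^sup>2 / x + \<kappa>\<^sup>2 * x * (f x)\<^sup>2"
    using assms(1) unfolding bessel_energy_def by (simp add: field_simps power2_eq_square)
  moreover have "0 \<le> (x * f1 x + f x / 2)\<^sup>2 / x" "0 \<le> \<kappa>\<^sup>2 * x * (f x)\<^sup>2"
    using assms by auto
  ultimately have "\<kappa>\<^sup>2 * x * (f x)\<^sup>2 = 0"
    using assms(3) by linarith
  then show ?thesis
    using assms by simp
qed

text \<open>The derivative of g'^2 + \<kappa>^2 g^2 is 2 g' (g'' + \<kappa>^2 g), and the equation
  for g turns the bracket into (m - 1/4) g / x^2. The oscillatory part cancels and only the term of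
  order 1/x^2 survives.\<close>

lemma bessel_energy_deriv:
  assumes "0 < x"
    and "(f has_real_derivative f1 x) (at x)"
    and "(f1 has_real_derivative f2) (at x)"
    and ode: "x\<^sup>2 * f2 + x * f1 x + (\<kappa>\<^sup>2 * x\<^sup>2 - m) * f x = 0"
  shows "(bessel_energy \<kappa> f f1 has_real_derivative
    2 * (m - 1/4) / x\<^sup>2 * (x * f x * f1 x + (f x)\<^sup>2 / 2)) (at x)"
proof -
  have f2: "f2 = - f1 x / x - \<kappa>\<^sup>2 * f x + m * f x / x\<^sup>2"
    using ode assms(1) by (simp add: field_simps power2_eq_square)
  have "(bessel_energy \<kappa> f f1 has_real_derivative
      ((f1 x)\<^sup>2 + x * (2 * f1 x * f2) + (f1 x * f1 x + f x * f2)
        + (2 * f x * f1 x * (4 * x) - (f x)\<^sup>2 * 4) / (4 * x)\<^sup>2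
        + (\<kappa>\<^sup>2 * (f x)\<^sup>2 + \<kappa>\<^sup>2 * x * (2 * f x * f1 x)))) (at x)"
    unfolding bessel_energy_def[abs_def]
    by (rule derivative_eq_intros assms(2,3) refl | use assms(1) in \<open>simp add: power2_eq_square\<close>)+
  also have "(f1 x)\<^sup>2 + x * (2 * f1 x * f2) + (f1 x * f1 x + f x * f2)
        + (2 * f x * f1 x * (4 * x) - (f x)\<^sup>2 * 4) / (4 * x)\<^sup>2
        + (\<kappa>\<^sup>2 * (f x)\<^sup>2 + \<kappa>\<^sup>2 * x * (2 * f x * f1 x))
      = 2 * (m - 1/4) / x\<^sup>2 * (x * f x * f1 x + (f x)\<^sup>2 / 2)"
    unfolding f2 using assms(1) by (simp add: field_simps power2_eq_square)
  finally show ?thesis .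
qed

text \<open>A two-sided Gronwall argument: |E'| \<le> K E / x^2, and exp(-K/x), exp(K/x) are the
  integrating factors. The first inequality carries information inward from large radii, the second
  outward; both factors tend to 1 at infinity.\<close>

lemma bessel_energy_compare:
  fixes f f1 f2 :: "real \<Rightarrow> real"
  assumes "0 < r" "r \<le> s" "0 < \<kappa>"
    and d1: "\<And>x. x \<in> {r..s} \<Longrightarrow> (f has_real_derivative f1 x) (at x)"
    and d2: "\<And>x. x \<in> {r..s} \<Longrightarrow> (f1 has_real_derivative f2 x) (at x)"
    and ode: "\<And>x. x \<in> {r..s} \<Longrightarrow> x\<^sup>2 * f2 x + x * f1 x + (\<kappa>\<^sup>2 * x\<^sup>2 - m) * f x = 0"
  defines "K \<equiv> \<bar>m - 1/4\<bar> / \<kappa>"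
  shows "bessel_energy \<kappa> f f1 r * exp (- K / r) \<le> bessel_energy \<kappa> f f1 s * exp (- K / s)"
    and "bessel_energy \<kappa> f f1 s * exp (K / s) \<le> bessel_energy \<kappa> f f1 r * exp (K / r)"
proof -
  let ?E = "bessel_energy \<kappa> f f1"
  define E' where "E' x = 2 * (m - 1/4) / x\<^sup>2 * (x * f x * f1 x + (f x)\<^sup>2 / 2)" for x
  have dE: "(?E has_real_derivative E' x) (at x)" if "x \<in> {r..s}" for x
    unfolding E'_def using that assms(1) by (intro bessel_energy_deriv[OF _ d1 d2 ode]) auto
  have bound: "\<bar>E' x\<bar> \<le> K / x\<^sup>2 * ?E x" if "x \<in> {r..s}" for x
  proof -
    have "x > 0" using that assms(1) by auto
    have "\<bar>E' x\<bar> = K / x\<^sup>2 * (2 * \<kappa> * \<bar>x * f x * f1 x + (f x)\<^sup>2 / 2\<bar>)"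
    proof -
      have "\<bar>2 * (m - 1 / 4)\<bar> = 2 * \<bar>m - 1 / 4\<bar>" by (simp only: abs_mult abs_numeral)
      then show ?thesis
        unfolding E'_def K_def abs_mult abs_divide using assms(3) by simp
    qed
    also have "\<dots> \<le> K / x\<^sup>2 * ?E x"
      using bessel_energy_bound[OF \<open>x > 0\<close>] assms(3)
      by (intro mult_left_mono) (auto simp: K_def)
    finally show ?thesis .
  qed
  show "?E r * exp (- K / r) \<le> ?E s * exp (- K / s)"
  proof (rule DERIV_nonneg_imp_nondecreasing[OF assms(2)])
    fix x assume "r \<le> x" "x \<le> s"
    then have x: "x \<in> {r..s}" "x > 0" using assms(1) by auto
    have "((\<lambda>x. ?E x * exp (- K / x)) has_real_derivative (E' x + K / x\<^sup>2 * ?E x) * exp (- K / x)) (at x)"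
      by (rule derivative_eq_intros dE[OF x(1)] refl | use x in \<open>simp add: field_simps power2_eq_square\<close>)+
    then show "\<exists>y. ((\<lambda>x. ?E x * exp (- K / x)) has_real_derivative y) (at x) \<and> 0 \<le> y"
      using bound[OF x(1)] by (intro exI conjI) auto
  qed
  show "?E s * exp (K / s) \<le> ?E r * exp (K / r)"
  proof (rule DERIV_nonpos_imp_nonincreasing[OF assms(2)])
    fix x assume "r \<le> x" "x \<le> s"
    then have x: "x \<in> {r..s}" "x > 0" using assms(1) by auto
    have "((\<lambda>x. ?E x * exp (K / x)) has_real_derivative (E' x - K / x\<^sup>2 * ?E x) * exp (K / x)) (at x)"
      by (rule derivative_eq_intros dE[OF x(1)] refl | use x in \<open>simp add: field_simps power2_eq_square\<close>)+
    then show "\<exists>y. ((\<lambda>x. ?E x * exp (K / x)) has_real_derivative y) (at x) \<and> y \<le> 0"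
      using bound[OF x(1)] by (intro exI conjI) (auto simp: mult_nonpos_nonneg)
  qed
qed

subsection \<open>Fourier coefficients on the circle\<close>

lemma integral_cis_of_int:
  "integral {0..2*pi} (\<lambda>t. cis (of_int n * t)) = (if n = 0 then 2 * pi else 0)"
proof (cases "n = 0")
  case False
  have "((\<lambda>t. cis (of_int n * t)) has_integral
    cis (of_int n * (2*pi)) / (\<i> * of_int n) - cis (of_int n * 0) / (\<i> * of_int n)) {0..2*pi}"
  proof (rule fundamental_theorem_of_calculus)
    fix t :: real
    show "((\<lambda>t. cis (of_int n * t) / (\<i> * of_int n)) has_vector_derivative cis (of_int n * t)) (at t within {0..2*pi})"
      unfolding has_vector_derivative_complex_iff
      using False
      by (auto intro!: derivative_eq_intros simp: Re_divide Im_divide power2_eq_square)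
  qed simp
  moreover have "cis (of_int n * (2*pi)) = 1"
    using cis_multiple_2pi[of "of_int n"] by (simp add: mult.commute)
  ultimately show ?thesis
    using False by (simp add: integral_unique)
qed (simp add: scaleR_conv_of_real)

lemma continuous_on_real_polynomial_cis:
  fixes p :: "complex \<Rightarrow> real"
  assumes "real_polynomial_function p"
  shows "continuous_on S (\<lambda>t. p (cis t))"
proof -
  have "polynomial_function p"
    using assms by (simp add: real_polynomial_function_eq)
  then show ?thesis
    by (intro continuous_on_compose2[OF continuous_on_polymonial_function[of p UNIV]])
       (auto intro!: continuous_intros)
qed

text \<open>On the circle a linear form is a combination of \<open>cis t\<close> and
  \<open>cis (- t)\<close>, so multiplying by it only shifts the index n. The induction is
  generalized over G so that a product can be handled one factor at a time: all moments of G p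
  vanish, and then G p takes the role of G for the factor q.\<close>

lemma integral_poly_cis_eq_0:
  fixes p :: "complex \<Rightarrow> real" and G :: "real \<Rightarrow> complex"
  assumes "real_polynomial_function p" "continuous_on {0..2*pi} G"
    and "\<And>n. integral {0..2*pi} (\<lambda>t. G t * cis (of_int n * t)) = 0"
  shows "integral {0..2*pi} (\<lambda>t. G t * of_real (p (cis t)) * cis (of_int n * t)) = 0"
  using assms
proof (induction arbitrary: G n)
  case (linear h)
  interpret bounded_linear h by fact
  have h: "of_real (h (cis t)) = (of_real (h 1) - \<i> * of_real (h \<i>)) / 2 * cis t
      + (of_real (h 1) + \<i> * of_real (h \<i>)) / 2 * cis (- t)" for t
  proof -
    have "h (cis t) = h (cos t *\<^sub>R 1 + sin t *\<^sub>R \<i>)"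
      by (rule arg_cong[where f=h]) (simp add: complex_eq_iff)
    also have "\<dots> = cos t * h 1 + sin t * h \<i>"
      by (simp only: add scaleR) simp
    finally show ?thesis
      by (simp add: complex_eq_iff field_simps)
  qed
  have "G t * of_real (h (cis t)) * cis (of_int n * t)
    = (of_real (h 1) - \<i> * of_real (h \<i>)) / 2 * (G t * cis (of_int (n + 1) * t))
      + (of_real (h 1) + \<i> * of_real (h \<i>)) / 2 * (G t * cis (of_int (n - 1) * t))" for t
  proof -
    have "cis (of_int (n + 1) * t) = cis t * cis (of_int n * t)"
      "cis (of_int (n - 1) * t) = cis (- t) * cis (of_int n * t)"
      by (auto simp: cis_mult algebra_simps)
    then show ?thesis unfolding h by (simp add: algebra_simps)
  qed
  moreover have "((\<lambda>t. G t * cis (of_int k * t)) has_integral 0) {0..2*pi}" for k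
    unfolding linear.prems(2)[of k, symmetric]
    by (intro integrable_integral integrable_continuous_interval continuous_intros linear.prems(1))
  note has_integral_add[OF this[THEN has_integral_mult_right] this[THEN has_integral_mult_right]]
  ultimately show ?case
    by (metis (no_types, lifting) add_0 integral_unique mult_zero_right ext)
next
  case (const c)
  have "(\<lambda>t. G t * of_real c * cis (of_int n * t)) = (\<lambda>t. of_real c * (G t * cis (of_int n * t)))"
    by (simp add: fun_eq_iff)
  then show ?case
    using const by simp
next
  case (add p q)
  have "(\<lambda>t. G t * of_real (f (cis t)) * cis (of_int n * t)) integrable_on {0..2*pi}"
    if "real_polynomial_function f" for f
    by (intro integrable_continuous_interval continuous_intros add.prems
        continuous_on_real_polynomial_cis that)
  then show ?case
    using add by (simp add: algebra_simps integral_add)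
next
  case (mult p q)
  have "continuous_on {0..2*pi} (\<lambda>t. G t * of_real (p (cis t)))"
    by (intro continuous_intros mult.prems continuous_on_real_polynomial_cis mult.hyps)
  from mult.IH(2)[OF this mult.IH(1)[OF mult.prems]]
  show ?case by (simp add: mult.assoc)
qed

text \<open>Completeness of the trigonometric system for continuous functions. Approximating the
  conjugate of g uniformly by polynomials, to which g is orthogonal, makes the integral of |g|^2
  arbitrarily small.\<close>

lemma fourier_unique:
  fixes g :: "complex \<Rightarrow> complex"
  assumes g: "continuous_on (sphere 0 1) g"
    and coeff: "\<And>n. integral {0..2*pi} (\<lambda>t. g (cis t) * cis (of_int n * t)) = 0"
    and "norm z = 1"
  shows "g z = 0"
proof -
  have cont: "continuous_on {0..2*pi} (\<lambda>t. g (cis t))"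
    by (rule continuous_on_compose2[OF g]) (auto intro!: continuous_intros)
  have "compact (g ` sphere 0 1)"
    by (intro compact_continuous_image g) simp
  then obtain B where B: "\<And>z. norm z = 1 \<Longrightarrow> norm (g z) \<le> B" "B > 0"
    by (metis compact_imp_bounded bounded_pos image_eqI mem_sphere_0)
  define J where "J = integral {0..2*pi} (\<lambda>t. (norm (g (cis t)))\<^sup>2)"
  have contp: "continuous_on {0..2*pi} (\<lambda>t. p (cis t))" if "polynomial_function p" for p :: "complex \<Rightarrow> complex"
    by (rule continuous_on_compose2[OF continuous_on_polymonial_function[OF that, of UNIV]])
       (auto intro!: continuous_intros)
  have "J \<le> e" if "e > 0" for e
  proof -
    \<comment> \<open>The error term is at most B d on an interval of length 2 pi, which is exactly
      e.\<close>
    define d where "d = e / (2 * pi * B)"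
    have "d > 0" unfolding d_def using \<open>e > 0\<close> B by simp
    have "continuous_on (sphere 0 1) (\<lambda>z. cnj (g z))"
      by (intro continuous_intros g)
    then obtain p where p: "polynomial_function p" "\<And>z. norm z = 1 \<Longrightarrow> norm (cnj (g z) - p z) < d"
      using Stone_Weierstrass_polynomial_function[of "sphere 0 1" "\<lambda>z. cnj (g z)" d] \<open>d > 0\<close> by auto
    \<comment> \<open>The approximant is complex valued, while orthogonality was shown for real
      polynomials; the two parts are treated separately and recombined.\<close>
    have "real_polynomial_function (\<lambda>z. Re (p z))" "real_polynomial_function (\<lambda>z. Im (p z))"
      using p(1) unfolding polynomial_function_iff_Basis_inner by (auto simp: Basis_complex_def)
    from this[THEN integral_poly_cis_eq_0, OF cont coeff, of 0]
    have "integral {0..2*pi} (\<lambda>t. g (cis t) * of_real (Re (p (cis t))) + \<i> * (g (cis t) * of_real (Im (p (cis t))))) = 0"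
      by (subst integral_add)
         (auto intro!: integrable_continuous_interval continuous_intros cont contp[OF p(1)])
    also have "(\<lambda>t. g (cis t) * of_real (Re (p (cis t))) + \<i> * (g (cis t) * of_real (Im (p (cis t))))) 
        = (\<lambda>t. g (cis t) * p (cis t))"
      by (simp add: fun_eq_iff complex_eq_iff algebra_simps)
    finally have gp: "integral {0..2*pi} (\<lambda>t. g (cis t) * p (cis t)) = 0" .
    have "complex_of_real J = integral {0..2*pi} (\<lambda>t. of_real ((norm (g (cis t)))\<^sup>2))"
      unfolding J_def
      using integral_linear[of "\<lambda>t. (norm (g (cis t)))\<^sup>2" "{0..2*pi}" complex_of_real]
      by (simp add: o_def bounded_linear_of_real integrable_continuous_interval continuous_intros cont)
    also have "\<dots> = integral {0..2*pi} (\<lambda>t. g (cis t) * p (cis t) + g (cis t) * (cnj (g (cis t)) - p (cis t)))"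
      by (simp only: complex_norm_square) (simp add: right_diff_distrib)
    also have "\<dots> = integral {0..2*pi} (\<lambda>t. g (cis t) * (cnj (g (cis t)) - p (cis t)))"
      by (subst integral_add)
         (auto intro!: integrable_continuous_interval continuous_intros cont contp[OF p(1)] simp: gp)
    also have "norm \<dots> \<le> B * d * (2 * pi - 0)"
    proof (rule integral_bound)
      show "norm (g (cis t) * (cnj (g (cis t)) - p (cis t))) \<le> B * d" for t
        unfolding norm_mult using B p(2)[of "cis t"] by (intro mult_mono) (auto simp: less_imp_le)
    qed (auto intro!: continuous_intros cont contp[OF p(1)])
    finally show ?thesis
      using B by (simp add: d_def)
  qed
  then have "J \<le> 0"
    using field_le_epsilon[of J 0] by simp
  have J: "((\<lambda>t. (norm (g (cis t)))\<^sup>2) has_integral J) {0..2*pi}"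
    unfolding J_def by (intro integrable_integral integrable_continuous_interval continuous_intros cont)
  moreover have "J \<ge> 0"
    by (rule has_integral_nonneg[OF J]) simp
  ultimately have "((\<lambda>t. (norm (g (cis t)))\<^sup>2) has_integral 0) (cbox 0 (2*pi))"
    using \<open>J \<le> 0\<close> by simp
  then have *: "(norm (g (cis t)))\<^sup>2 = 0" if "t \<in> {0..2*pi}" for t
    using that by (intro has_integral_0_cbox_imp_0[of 0 "2*pi" "\<lambda>t. (norm (g (cis t)))\<^sup>2"])
      (auto intro!: continuous_intros cont simp: pi_gt_zero not_le)
  obtain t where "0 \<le> t" "t < 2 * pi" "z = cis t"
    using complex_unimodular_polar[OF \<open>norm z = 1\<close>] by (auto simp: complex_eq_iff)
  with *[of t] show ?thesis by simp
qed

subsection \<open>Solutions of the Helmholtz equation in the complex plane\<close>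

text \<open>The direction precedes the point, so \<open>dir_deriv f h\<close> is again a function on
  the plane and second derivatives are plain iterates. The value carries information only at points
  of differentiability.\<close>

definition dir_deriv :: "('a::real_normed_vector \<Rightarrow> 'b::real_normed_vector) \<Rightarrow> 'a \<Rightarrow> 'a \<Rightarrow> 'b" where
  "dir_deriv f h z = frechet_derivative f (at z) h"

lemma dir_derivI: "(f has_derivative D) (at z) \<Longrightarrow> dir_deriv f h z = D h"
  by (metis dir_deriv_def frechet_derivative_at)

lemma has_dir_deriv:
  "f differentiable (at z) \<Longrightarrow> (f has_derivative (\<lambda>h. dir_deriv f h z)) (at z)"
  unfolding dir_deriv_def[abs_def] by (simp add: frechet_derivative_works)

lemma differentiable_cong_open:
  assumes "open U" "z \<in> U" "\<And>x. x \<in> U \<Longrightarrow> f x = g x" "f differentiable (at z)"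
  shows "g differentiable (at z)" "dir_deriv g h z = dir_deriv f h z"
proof -
  have "(g has_derivative (\<lambda>h. dir_deriv f h z)) (at z)"
    by (rule has_derivative_transform_within_open[OF has_dir_deriv[OF assms(4)] assms(1,2)]) (simp add: assms(3))
  then show "g differentiable (at z)" "dir_deriv g h z = dir_deriv f h z"
    unfolding differentiable_def by (blast, rule dir_derivI)
qed

text \<open>Openness and C^2 regularity are bundled with the equation. Quantifying over all
  directions makes the derivatives along rays and circles available, where the direction depends on
  the point.\<close>

definition helmholtz :: "real \<Rightarrow> complex set \<Rightarrow> (complex \<Rightarrow> complex) \<Rightarrow> bool" where
  "helmholtz \<kappa> U f \<longleftrightarrow> open U \<and>
    (\<forall>z\<in>U. f differentiable (at z)) \<and>
    (\<forall>h. \<forall>z\<in>U. dir_deriv f h differentiable (at z)) \<and>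
    (\<forall>h k. continuous_on U (dir_deriv (dir_deriv f h) k)) \<and>
    (\<forall>z\<in>U. dir_deriv (dir_deriv f 1) 1 z + dir_deriv (dir_deriv f \<i>) \<i> z
       + of_real (\<kappa>\<^sup>2) * f z = 0)"

lemma helmholtzI:
  assumes "open U"
    and D: "\<And>z. z \<in> U \<Longrightarrow> (f has_derivative D z) (at z)"
    and D2: "\<And>z h. z \<in> U \<Longrightarrow> ((\<lambda>z. D z h) has_derivative D2 z h) (at z)"
    and cont: "\<And>h k. continuous_on U (\<lambda>z. D2 z h k)"
    and eq: "\<And>z. z \<in> U \<Longrightarrow> D2 z 1 1 + D2 z \<i> \<i> + of_real (\<kappa>\<^sup>2) * f z = 0"
  shows "helmholtz \<kappa> U f"
proof -
  have d1: "dir_deriv f h z = D z h" if "z \<in> U" for z h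
    by (rule dir_derivI[OF D[OF that]])
  have *: "(dir_deriv f h has_derivative D2 z h) (at z)" if "z \<in> U" for z h
    by (rule has_derivative_transform_within_open[OF D2[OF that] \<open>open U\<close> that]) (simp add: d1)
  have d2: "dir_deriv (dir_deriv f h) k z = D2 z h k" if "z \<in> U" for z h k
    by (rule dir_derivI[OF *[OF that]])
  show ?thesis
    unfolding helmholtz_def differentiable_def
  proof (intro conjI ballI allI)
    show "continuous_on U (dir_deriv (dir_deriv f h) k)" for h k
      by (rule continuous_on_eq[OF cont]) (rule d2[symmetric])
    show "open U" by fact
    show "\<exists>D. (f has_derivative D) (at z)" if "z \<in> U" for z
      using D[OF that] by blast
    show "\<exists>D. (dir_deriv f h has_derivative D) (at z)" if "z \<in> U" for z h
      using *[OF that] by blast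
    show "dir_deriv (dir_deriv f 1) 1 z + dir_deriv (dir_deriv f \<i>) \<i> z
       + of_real (\<kappa>\<^sup>2) * f z = 0" if "z \<in> U" for z
      unfolding d2[OF that] by (rule eq[OF that])
  qed
qed

locale helmholtz_on =
  fixes \<kappa> :: real and U :: "complex set" and f :: "complex \<Rightarrow> complex"
  assumes helmholtz: "helmholtz \<kappa> U f"
begin

lemma open_U: "open U"
  using helmholtz by (simp add: helmholtz_def)

lemma has_deriv: "z \<in> U \<Longrightarrow> (f has_derivative (\<lambda>h. dir_deriv f h z)) (at z)"
  using helmholtz by (simp add: helmholtz_def has_dir_deriv)

lemma has_deriv2:
  "z \<in> U \<Longrightarrow> (dir_deriv f h has_derivative (\<lambda>k. dir_deriv (dir_deriv f h) k z)) (at z)"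
  using helmholtz by (simp add: helmholtz_def has_dir_deriv)

lemma cont: "continuous_on U f"
  by (intro continuous_at_imp_continuous_on ballI has_derivative_continuous[OF has_deriv])

lemma cont1: "continuous_on U (dir_deriv f h)"
  by (intro continuous_at_imp_continuous_on ballI has_derivative_continuous[OF has_deriv2])

lemma cont2: "continuous_on U (dir_deriv (dir_deriv f h) k)"
  using helmholtz by (simp add: helmholtz_def)

lemma equation: "z \<in> U \<Longrightarrow> dir_deriv (dir_deriv f 1) 1 z + dir_deriv (dir_deriv f \<i>) \<i> z
    = - of_real (\<kappa>\<^sup>2) * f z"
  using helmholtz unfolding helmholtz_def by (simp add: eq_neg_iff_add_eq_0)

lemma linear1: "z \<in> U \<Longrightarrow> linear (\<lambda>h. dir_deriv f h z)"
  by (rule has_derivative_linear[OF has_deriv])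

lemma linear2: "z \<in> U \<Longrightarrow> linear (\<lambda>k. dir_deriv (dir_deriv f h) k z)"
  by (rule has_derivative_linear[OF has_deriv2])

text \<open>Linearity in the inner direction is inherited by differentiation: the first derivative
  is linear in h at every point of the open set U, so both sides are derivatives of functions that
  agree near z.\<close>

lemma linear2':
  assumes "z \<in> U"
  shows "linear (\<lambda>h. dir_deriv (dir_deriv f h) k z)"
proof (rule linearI)
  fix h1 h2
  have "((\<lambda>x. dir_deriv f h1 x + dir_deriv f h2 x) has_derivative
      (\<lambda>k. dir_deriv (dir_deriv f h1) k z + dir_deriv (dir_deriv f h2) k z)) (at z)"
    by (intro has_derivative_add has_deriv2 assms)
  then have "(dir_deriv f (h1 + h2) has_derivative
      (\<lambda>k. dir_deriv (dir_deriv f h1) k z + dir_deriv (dir_deriv f h2) k z)) (at z)"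
    by (rule has_derivative_transform_within_open[OF _ open_U assms]) (simp add: linear_add[OF linear1])
  then show "dir_deriv (dir_deriv f (h1 + h2)) k z =
      dir_deriv (dir_deriv f h1) k z + dir_deriv (dir_deriv f h2) k z"
    by (rule dir_derivI)
next
  fix c h
  have "((\<lambda>x. c *\<^sub>R dir_deriv f h x) has_derivative
      (\<lambda>k. c *\<^sub>R dir_deriv (dir_deriv f h) k z)) (at z)"
    by (intro has_derivative_scaleR_right has_deriv2 assms)
  then have "(dir_deriv f (c *\<^sub>R h) has_derivative
      (\<lambda>k. c *\<^sub>R dir_deriv (dir_deriv f h) k z)) (at z)"
    by (rule has_derivative_transform_within_open[OF _ open_U assms]) (simp add: linear_scale[OF linear1])
  then show "dir_deriv (dir_deriv f (c *\<^sub>R h)) k z = c *\<^sub>R dir_deriv (dir_deriv f h) k z"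
    by (rule dir_derivI)
qed

lemma dir_deriv_expand:
  assumes "z \<in> U"
  shows "dir_deriv f h z = of_real (Re h) * dir_deriv f 1 z + of_real (Im h) * dir_deriv f \<i> z"
proof -
  have "h = Re h *\<^sub>R 1 + Im h *\<^sub>R \<i>"
    by (simp add: complex_eq_iff)
  then have "dir_deriv f h z = dir_deriv f (Re h *\<^sub>R 1 + Im h *\<^sub>R \<i>) z"
    by (rule arg_cong)
  also have "\<dots> = Re h *\<^sub>R dir_deriv f 1 z + Im h *\<^sub>R dir_deriv f \<i> z"
    by (simp only: linear_add[OF linear1[OF assms]] linear_scale[OF linear1[OF assms]])
  finally show ?thesis
    by (simp only: scaleR_conv_of_real)
qed

lemma dir_deriv2_expand:
  assumes "z \<in> U"
  shows "dir_deriv (dir_deriv f h) k z =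
      of_real (Re h * Re k) * dir_deriv (dir_deriv f 1) 1 z
    + of_real (Re h * Im k) * dir_deriv (dir_deriv f 1) \<i> z
    + of_real (Im h * Re k) * dir_deriv (dir_deriv f \<i>) 1 z
    + of_real (Im h * Im k) * dir_deriv (dir_deriv f \<i>) \<i> z"
proof -
  have eq: "Re h *\<^sub>R 1 + Im h *\<^sub>R \<i> = h" for h
    by (simp add: complex_eq_iff)
  have *: "dir_deriv (dir_deriv f h) (Re k *\<^sub>R 1 + Im k *\<^sub>R \<i>) z
      = Re k *\<^sub>R dir_deriv (dir_deriv f h) 1 z + Im k *\<^sub>R dir_deriv (dir_deriv f h) \<i> z"
    by (simp only: linear_add[OF linear2[OF assms]] linear_scale[OF linear2[OF assms]])
  have **: "dir_deriv (dir_deriv f (Re h *\<^sub>R 1 + Im h *\<^sub>R \<i>)) k z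
      = Re h *\<^sub>R dir_deriv (dir_deriv f 1) k z + Im h *\<^sub>R dir_deriv (dir_deriv f \<i>) k z" for k
    by (simp only: linear_add[OF linear2'[OF assms]] linear_scale[OF linear2'[OF assms]])
  show ?thesis
    unfolding *[unfolded eq] **[of 1, unfolded eq] **[of \<i>, unfolded eq] scaleR_conv_of_real of_real_mult by algebra
qed

text \<open>The Laplacian is a trace and can be computed in any orthonormal frame. In the frame h,
  ih the mixed terms come with opposite signs and cancel.\<close>

lemma trace_isometry:
  assumes "z \<in> U" "norm h = 1"
  shows "dir_deriv (dir_deriv f h) h z + dir_deriv (dir_deriv f (\<i> * h)) (\<i> * h) z
    = - of_real (\<kappa>\<^sup>2) * f z"
proof -
  have *: "Re h * Re h + Im h * Im h = 1"
    using assms(2) by (simp add: cmod_def power2_eq_square)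
  have "dir_deriv (dir_deriv f h) h z + dir_deriv (dir_deriv f (\<i> * h)) (\<i> * h) z
    = of_real (Re h * Re h + Im h * Im h) *
      (dir_deriv (dir_deriv f 1) 1 z + dir_deriv (dir_deriv f \<i>) \<i> z)"
    unfolding dir_deriv2_expand[OF assms(1), of h h] dir_deriv2_expand[OF assms(1), of "\<i>*h" "\<i>*h"]
      Re_i_times Im_i_times of_real_mult of_real_add of_real_minus
    by algebra
  then show ?thesis
    unfolding * using equation[OF assms(1)] by simp
qed

end

text \<open>Unnormalized, and with the opposite sign convention for the index, which is harmless
  because n runs over all integers. The radius may be zero or negative, so coefficients can be
  differentiated at the center.\<close>

definition fourier_coeff :: "(complex \<Rightarrow> complex) \<Rightarrow> complex \<Rightarrow> int \<Rightarrow> real \<Rightarrow> complex" where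
  "fourier_coeff f p n r = integral {0..2*pi} (\<lambda>t. f (p + of_real r * cis t) * cis (of_int n * t))"

definition fourier_coeff' :: "(complex \<Rightarrow> complex) \<Rightarrow> complex \<Rightarrow> int \<Rightarrow> real \<Rightarrow> complex" where
  "fourier_coeff' f p n r =
    integral {0..2*pi} (\<lambda>t. dir_deriv f (cis t) (p + of_real r * cis t) * cis (of_int n * t))"

definition fourier_coeff'' :: "(complex \<Rightarrow> complex) \<Rightarrow> complex \<Rightarrow> int \<Rightarrow> real \<Rightarrow> complex" where
  "fourier_coeff'' f p n r = integral {0..2*pi} (\<lambda>t.
    dir_deriv (dir_deriv f (cis t)) (cis t) (p + of_real r * cis t) * cis (of_int n * t))"

lemma has_vector_derivative_compose_has_derivative:
  assumes "(c has_vector_derivative v) (at t)" "(g has_derivative D) (at (c t))"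
  shows "((\<lambda>t. g (c t)) has_vector_derivative D v) (at t)"
  unfolding has_vector_derivative_def
  using has_derivative_compose[OF assms(1)[unfolded has_vector_derivative_def] assms(2)]
  by (simp add: linear_scale[OF has_derivative_linear[OF assms(2)]])

context helmholtz_on
begin

lemma radial_deriv:
  assumes "p + of_real r * h \<in> U"
  shows "((\<lambda>r. f (p + of_real r * h)) has_vector_derivative dir_deriv f h (p + of_real r * h)) (at r)"
    and "((\<lambda>r. dir_deriv f k (p + of_real r * h)) has_vector_derivative
      dir_deriv (dir_deriv f k) h (p + of_real r * h)) (at r)"
proof -
  have *: "((\<lambda>r. p + of_real r * h) has_vector_derivative h) (at r)"
    by (auto intro!: derivative_eq_intros simp: has_vector_derivative_def scaleR_conv_of_real)
  show "((\<lambda>r. f (p + of_real r * h)) has_vector_derivative dir_deriv f h (p + of_real r * h)) (at r)"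
    by (rule has_vector_derivative_compose_has_derivative[OF * has_deriv[OF assms]])
  show "((\<lambda>r. dir_deriv f k (p + of_real r * h)) has_vector_derivative
      dir_deriv (dir_deriv f k) h (p + of_real r * h)) (at r)"
    by (rule has_vector_derivative_compose_has_derivative[OF * has_deriv2[OF assms]])
qed

text \<open>The direction \<open>cis (T x)\<close> moves with the point, whereas continuity is known
  for fixed directions; expanding in the directions 1 and i separates the two dependences. Arbitrary
  R and T cover a single circle as well as the product set in the Leibniz rule.\<close>

lemma continuous_polar:
  assumes "\<And>x. x \<in> S \<Longrightarrow> p + of_real (R x) * cis (T x) \<in> U"
    and [continuous_intros]: "continuous_on S R" "continuous_on S T"
  shows "continuous_on S (\<lambda>x. f (p + of_real (R x) * cis (T x)))"
    and "continuous_on S (\<lambda>x. dir_deriv f (cis (T x)) (p + of_real (R x) * cis (T x)))"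
    and "continuous_on S (\<lambda>x. dir_deriv (dir_deriv f (cis (T x))) (cis (T x))
        (p + of_real (R x) * cis (T x)))"
proof -
  have *: "continuous_on S (\<lambda>x. g (p + of_real (R x) * cis (T x)))" if "continuous_on U g" for g :: "complex \<Rightarrow> complex"
    by (rule continuous_on_compose2[OF that]) (use assms(1) in \<open>auto intro!: continuous_intros\<close>)
  show "continuous_on S (\<lambda>x. f (p + of_real (R x) * cis (T x)))"
    by (rule *[OF cont])
  have "continuous_on S (\<lambda>x. of_real (Re (cis (T x))) * dir_deriv f 1 (p + of_real (R x) * cis (T x))
      + of_real (Im (cis (T x))) * dir_deriv f \<i> (p + of_real (R x) * cis (T x)))"
    by (intro continuous_intros *[OF cont1])
  then show "continuous_on S (\<lambda>x. dir_deriv f (cis (T x)) (p + of_real (R x) * cis (T x)))"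
    by (rule continuous_on_eq) (rule dir_deriv_expand[symmetric], rule assms)
  have "continuous_on S (\<lambda>x. let h = cis (T x); z = p + of_real (R x) * cis (T x) in
      of_real (Re h * Re h) * dir_deriv (dir_deriv f 1) 1 z
    + of_real (Re h * Im h) * dir_deriv (dir_deriv f 1) \<i> z
    + of_real (Im h * Re h) * dir_deriv (dir_deriv f \<i>) 1 z
    + of_real (Im h * Im h) * dir_deriv (dir_deriv f \<i>) \<i> z)"
    unfolding Let_def
    by (intro continuous_intros *[OF cont2])
  then show "continuous_on S (\<lambda>x. dir_deriv (dir_deriv f (cis (T x))) (cis (T x))
        (p + of_real (R x) * cis (T x)))"
    by (rule continuous_on_eq) (unfold Let_def, rule dir_deriv2_expand[symmetric], rule assms)
qed

lemma integrable_polar: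
  assumes "\<And>t. p + of_real r * cis t \<in> U"
  shows "(\<lambda>t. f (p + of_real r * cis t) * cis (of_int n * t)) integrable_on {0..2*pi}"
    and "(\<lambda>t. dir_deriv f (cis t) (p + of_real r * cis t) * cis (of_int n * t)) integrable_on {0..2*pi}"
    and "(\<lambda>t. dir_deriv (dir_deriv f (cis t)) (cis t) (p + of_real r * cis t) * cis (of_int n * t))
      integrable_on {0..2*pi}"
  using assms by (auto intro!: integrable_continuous_interval continuous_on_mult continuous_polar continuous_intros)

lemma fourier_coeff_deriv:
  assumes I: "open I" "convex I" "r \<in> I" and sub: "\<And>r t. r \<in> I \<Longrightarrow> p + of_real r * cis t \<in> U"
  shows "(fourier_coeff f p n has_vector_derivative fourier_coeff' f p n r) (at r)"
    and "(fourier_coeff' f p n has_vector_derivative fourier_coeff'' f p n r) (at r)"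
proof -
  have eq: "at r within I = at r"
    by (rule at_within_open[OF I(3,1)])
  define F0 where "F0 r t = f (p + of_real r * cis t) * cis (of_int n * t)" for r t
  define F1 where "F1 r t = dir_deriv f (cis t) (p + of_real r * cis t) * cis (of_int n * t)" for r t
  define F2 where "F2 r t = dir_deriv (dir_deriv f (cis t)) (cis t) (p + of_real r * cis t) * cis (of_int n * t)" for r t
  have "((\<lambda>r. integral (cbox 0 (2*pi)) (F0 r)) has_vector_derivative
      integral (cbox 0 (2*pi)) (F1 r)) (at r within I)"
  proof (rule leibniz_rule_vector_derivative[where f=F0 and fx=F1])
    show "((\<lambda>r. F0 r t) has_vector_derivative F1 r t) (at r within I)" if "r \<in> I" for r t
      unfolding F0_def F1_def
      by (rule has_vector_derivative_at_within, rule has_vector_derivative_mult_left)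
         (intro radial_deriv sub that)
    show "F0 r integrable_on cbox 0 (2*pi)" if "r \<in> I" for r
      unfolding cbox_interval F0_def[abs_def] by (rule integrable_polar(1) sub that)+
    show "continuous_on (I \<times> cbox 0 (2*pi)) (\<lambda>(r, t). F1 r t)"
      unfolding split_beta F1_def
      by (rule continuous_on_mult[OF continuous_polar(2)])
         (auto intro!: continuous_intros sub)
  qed (use I in auto)
  then show "(fourier_coeff f p n has_vector_derivative fourier_coeff' f p n r) (at r)"
    unfolding fourier_coeff_def[abs_def] fourier_coeff'_def cbox_interval eq F0_def[abs_def] F1_def[abs_def] .
  have "((\<lambda>r. integral (cbox 0 (2*pi)) (F1 r)) has_vector_derivative
      integral (cbox 0 (2*pi)) (F2 r)) (at r within I)"
  proof (rule leibniz_rule_vector_derivative[where f=F1 and fx=F2])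
    show "((\<lambda>r. F1 r t) has_vector_derivative F2 r t) (at r within I)" if "r \<in> I" for r t
      unfolding F1_def F2_def
      by (rule has_vector_derivative_at_within, rule has_vector_derivative_mult_left)
         (intro radial_deriv sub that)
    show "F1 r integrable_on cbox 0 (2*pi)" if "r \<in> I" for r
      unfolding cbox_interval F1_def[abs_def] by (rule integrable_polar(2) sub that)+
    show "continuous_on (I \<times> cbox 0 (2*pi)) (\<lambda>(r, t). F2 r t)"
      unfolding split_beta F2_def
      by (rule continuous_on_mult[OF continuous_polar(3)])
         (auto intro!: continuous_intros sub)
  qed (use I in auto)
  then show "(fourier_coeff' f p n has_vector_derivative fourier_coeff'' f p n r) (at r)"
    unfolding fourier_coeff'_def[abs_def] fourier_coeff''_def cbox_interval eq F1_def[abs_def] F2_def[abs_def] .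
qed

text \<open>The first-order term in the second formula arises because the tangent direction i cis t
  itself turns, with derivative - cis t.\<close>

lemma angular_deriv:
  assumes "p + of_real r * cis t \<in> U"
  shows "((\<lambda>t. f (p + of_real r * cis t)) has_vector_derivative
      of_real r * dir_deriv f (\<i> * cis t) (p + of_real r * cis t)) (at t)"
    and "((\<lambda>t. of_real r * dir_deriv f (\<i> * cis t) (p + of_real r * cis t)) has_vector_derivative
      - of_real r * dir_deriv f (cis t) (p + of_real r * cis t)
      + (of_real r)\<^sup>2 * dir_deriv (dir_deriv f (\<i> * cis t)) (\<i> * cis t) (p + of_real r * cis t)) (at t)"
proof -
  have cis: "((\<lambda>t. p + of_real r * cis t) has_vector_derivative of_real r * (\<i> * cis t)) (at t)"
    unfolding has_vector_derivative_complex_iff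
    by (auto intro!: derivative_eq_intros)
  let ?z = "p + of_real r * cis t"
  note chain = has_vector_derivative_compose_has_derivative[OF cis]
  have d1_scale: "dir_deriv f (of_real r * h) ?z = of_real r * dir_deriv f h ?z" for h
    using linear_scale[OF linear1[OF assms], of r h] by (simp only: scaleR_conv_of_real)
  have d2_scale: "dir_deriv (dir_deriv f k) (of_real r * h) ?z = of_real r * dir_deriv (dir_deriv f k) h ?z" for k h
    using linear_scale[OF linear2[OF assms], of k r h] by (simp only: scaleR_conv_of_real)
  show "((\<lambda>t. f (p + of_real r * cis t)) has_vector_derivative
      of_real r * dir_deriv f (\<i> * cis t) (p + of_real r * cis t)) (at t)"
    using chain[OF has_deriv[OF assms]] unfolding d1_scale .
  have d2: "((\<lambda>t. dir_deriv f k (p + of_real r * cis t)) has_vector_derivative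
      of_real r * dir_deriv (dir_deriv f k) (\<i> * cis t) (p + of_real r * cis t)) (at t)" for k
    using chain[OF has_deriv2[OF assms], of k] unfolding d2_scale .
  have op: "open ((\<lambda>t. p + of_real r * cis t) -` U)"
    by (intro open_vimage open_U continuous_intros)
  \<comment> \<open>Since the direction varies with t, the derivative is first written in the fixed
    directions 1 and i, and then the product rule applies.\<close>
  have "((\<lambda>t. of_real r * dir_deriv f (\<i> * cis t) (p + of_real r * cis t)) has_vector_derivative D) (at t)"
    if "((\<lambda>t. of_real r * (of_real (- sin t) * dir_deriv f 1 (p + of_real r * cis t)
        + of_real (cos t) * dir_deriv f \<i> (p + of_real r * cis t))) has_vector_derivative D) (at t)" for D
    by (rule has_vector_derivative_transform_within_open[OF that op])
       (use assms in \<open>simp_all add: dir_deriv_expand[of _ "\<i> * cis _"]\<close>)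
  moreover have "((\<lambda>t. of_real r * (of_real (- sin t) * dir_deriv f 1 (p + of_real r * cis t)
        + of_real (cos t) * dir_deriv f \<i> (p + of_real r * cis t))) has_vector_derivative
     of_real r * (of_real (- sin t) * (of_real r * dir_deriv (dir_deriv f 1) (\<i> * cis t) ?z)
        + of_real (- cos t) * dir_deriv f 1 ?z
        + (of_real (cos t) * (of_real r * dir_deriv (dir_deriv f \<i>) (\<i> * cis t) ?z)
        + of_real (- sin t) * dir_deriv f \<i> ?z))) (at t)"
    by (intro has_vector_derivative_mult_right has_vector_derivative_add has_vector_derivative_mult
        d2 has_vector_derivative_of_real)
       (auto intro!: derivative_eq_intros)
  moreover have "of_real r * (of_real (- sin t) * (of_real r * dir_deriv (dir_deriv f 1) (\<i> * cis t) ?z)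
        + of_real (- cos t) * dir_deriv f 1 ?z
        + (of_real (cos t) * (of_real r * dir_deriv (dir_deriv f \<i>) (\<i> * cis t) ?z)
        + of_real (- sin t) * dir_deriv f \<i> ?z))
     = - of_real r * dir_deriv f (cis t) (p + of_real r * cis t)
      + (of_real r)\<^sup>2 * dir_deriv (dir_deriv f (\<i> * cis t)) (\<i> * cis t) (p + of_real r * cis t)"
    unfolding dir_deriv_expand[OF assms, of "cis t"]
      dir_deriv2_expand[OF assms, of 1 "\<i> * cis t"] dir_deriv2_expand[OF assms, of \<i> "\<i> * cis t"]
      dir_deriv2_expand[OF assms, of "\<i> * cis t" "\<i> * cis t"]
    by (simp add: power2_eq_square) algebra
  ultimately show "((\<lambda>t. of_real r * dir_deriv f (\<i> * cis t) (p + of_real r * cis t)) has_vector_derivative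
      - of_real r * dir_deriv f (cis t) (p + of_real r * cis t)
      + (of_real r)\<^sup>2 * dir_deriv (dir_deriv f (\<i> * cis t)) (\<i> * cis t) (p + of_real r * cis t)) (at t)"
    by simp
qed

text \<open>Separation of variables: r^2 times the Laplacian is r^2 f_rr + r f_r + f_tt, and two
  integrations by parts in the angle replace f_tt by - n^2 f.\<close>

lemma bessel_ode:
  assumes sub: "\<And>t. p + of_real r * cis t \<in> U"
  shows "of_real (r\<^sup>2) * fourier_coeff'' f p n r + of_real r * fourier_coeff' f p n r
    + of_real (\<kappa>\<^sup>2 * r\<^sup>2 - (of_int n)\<^sup>2) * fourier_coeff f p n r = 0"
proof -
  define z where "z t = p + of_real r * cis t" for t
  define c where "c t = cis (of_int n * t)" for t
  define ft where "ft t = of_real r * dir_deriv f (\<i> * cis t) (z t)" for t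
  define ftt where "ftt t = - of_real r * dir_deriv f (cis t) (z t)
      + (of_real r)\<^sup>2 * dir_deriv (dir_deriv f (\<i> * cis t)) (\<i> * cis t) (z t)" for t
  have zU: "z t \<in> U" for t using sub by (simp add: z_def)
  \<comment> \<open>H collects the boundary terms of both integrations by parts. It is 2 pi
    periodic, so the integral of its derivative vanishes.\<close>
  define H where "H t = (ft t - \<i> * of_int n * f (z t)) * c t" for t
  have c: "(c has_vector_derivative \<i> * of_int n * c t) (at t)" for t
    unfolding c_def[abs_def] has_vector_derivative_complex_iff
    by (auto intro!: derivative_eq_intros)
  have f: "((\<lambda>t. f (z t)) has_vector_derivative ft t) (at t)"
    and ft: "(ft has_vector_derivative ftt t) (at t)" for t
    unfolding ft_def[abs_def] ftt_def z_def using angular_deriv[OF sub, of t] by auto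
  have H: "(H has_vector_derivative (ftt t + (of_int n)\<^sup>2 * f (z t)) * c t) (at t)" for t
  proof -
    have "(H has_vector_derivative (ft t - \<i> * of_int n * f (z t)) * (\<i> * of_int n * c t)
        + (ftt t - \<i> * of_int n * ft t) * c t) (at t)"
      unfolding H_def[abs_def]
      by (intro has_vector_derivative_mult has_vector_derivative_diff
          has_vector_derivative_mult_right f ft c)
    moreover have "(ft t - \<i> * of_int n * f (z t)) * (\<i> * of_int n * c t)
        + (ftt t - \<i> * of_int n * ft t) * c t = (ftt t + (of_int n)\<^sup>2 * f (z t)) * c t"
      by (simp add: algebra_simps power2_eq_square)
    ultimately show ?thesis by simp
  qed
  have "((\<lambda>t. (ftt t + (of_int n)\<^sup>2 * f (z t)) * c t) has_integral H (2*pi) - H 0) {0..2*pi}"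
    by (rule fundamental_theorem_of_calculus) (simp, rule has_vector_derivative_at_within[OF H])
  also have "H (2*pi) = H 0"
    using cis_multiple_2pi[of "of_int n"]
    by (simp add: H_def ft_def z_def c_def mult.commute[of _ "2 * pi"])
  finally have i1: "((\<lambda>t. (ftt t + (of_int n)\<^sup>2 * f (z t)) * c t) has_integral 0) {0..2*pi}"
    by simp
  have i2: "((\<lambda>t. of_real (r\<^sup>2) * (dir_deriv (dir_deriv f (cis t)) (cis t) (z t) * c t)
      + of_real r * (dir_deriv f (cis t) (z t) * c t)
      + of_real (\<kappa>\<^sup>2 * r\<^sup>2 - (of_int n)\<^sup>2) * (f (z t) * c t)) has_integral
      of_real (r\<^sup>2) * fourier_coeff'' f p n r + of_real r * fourier_coeff' f p n r
    + of_real (\<kappa>\<^sup>2 * r\<^sup>2 - (of_int n)\<^sup>2) * fourier_coeff f p n r) {0..2*pi}"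
    unfolding fourier_coeff_def fourier_coeff'_def fourier_coeff''_def z_def c_def
    by (intro has_integral_add has_integral_mult_right integrable_integral integrable_polar sub)
  have "of_real (r\<^sup>2) * (dir_deriv (dir_deriv f (cis t)) (cis t) (z t) * c t)
      + of_real r * (dir_deriv f (cis t) (z t) * c t)
      + of_real (\<kappa>\<^sup>2 * r\<^sup>2 - (of_int n)\<^sup>2) * (f (z t) * c t)
      = - ((ftt t + (of_int n)\<^sup>2 * f (z t)) * c t)" for t
  proof -
    show ?thesis
      using trace_isometry[OF zU, of "cis t" t]
      unfolding ftt_def norm_cis of_real_diff of_real_mult of_real_power of_real_of_int_eq
      by (simp only: simp_thms) algebra
  qed
  with i2 has_integral_neg[OF i1] show ?thesis
    by (metis (no_types, lifting) has_integral_unique minus_zero ext)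
qed

end

subsection \<open>Unique continuation and Rellich's lemma\<close>

lemma norm_mult_sgn: "of_real (norm z) * sgn z = (z :: complex)"
  by (simp add: sgn_div_norm scaleR_conv_of_real field_simps)

text \<open>Zero Cauchy data means zero energy at r, and the outward energy estimate keeps it
  zero.\<close>

lemma bessel_zero_forward:
  fixes u u1 u2 :: "real \<Rightarrow> real"
  assumes "0 < r" "r \<le> s" "0 < \<kappa>" "u r = 0" "u1 r = 0"
    and "\<And>x. x \<in> {r..s} \<Longrightarrow> (u has_real_derivative u1 x) (at x)"
    and "\<And>x. x \<in> {r..s} \<Longrightarrow> (u1 has_real_derivative u2 x) (at x)"
    and "\<And>x. x \<in> {r..s} \<Longrightarrow> x\<^sup>2 * u2 x + x * u1 x + (\<kappa>\<^sup>2 * x\<^sup>2 - m) * u x = 0"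
  shows "u s = 0"
proof -
  have "bessel_energy \<kappa> u u1 s * exp (\<bar>m - 1/4\<bar> / \<kappa> / s)
      \<le> bessel_energy \<kappa> u u1 r * exp (\<bar>m - 1/4\<bar> / \<kappa> / r)"
    using assms by (intro bessel_energy_compare(2)[of r s \<kappa> u u1 u2 m]) auto
  also have "bessel_energy \<kappa> u u1 r = 0"
    by (simp add: bessel_energy_def assms)
  finally have "bessel_energy \<kappa> u u1 s \<le> 0"
    by (simp add: mult_le_0_iff not_le[symmetric])
  with bessel_energy_nonneg[of s \<kappa> u u1] assms have "bessel_energy \<kappa> u u1 s = 0"
    by linarith
  then show ?thesis
    using bessel_energy_eq_0 assms by (meson less_le_trans)
qed

text \<open>The decay makes the energy tend to 0 at infinity, while the inward estimate bounds the
  energy at r by a fixed multiple of the energy at any s \<ge> r.\<close>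

lemma bessel_decay_zero:
  fixes u u1 u2 :: "real \<Rightarrow> real"
  assumes "0 < r" "0 < \<kappa>"
    and d1: "\<And>x. x \<ge> r \<Longrightarrow> (u has_real_derivative u1 x) (at x)"
    and d2: "\<And>x. x \<ge> r \<Longrightarrow> (u1 has_real_derivative u2 x) (at x)"
    and ode: "\<And>x. x \<ge> r \<Longrightarrow> x\<^sup>2 * u2 x + x * u1 x + (\<kappa>\<^sup>2 * x\<^sup>2 - m) * u x = 0"
    and lim: "((\<lambda>x. sqrt x * u x) \<longlongrightarrow> 0) at_top" "((\<lambda>x. sqrt x * u1 x) \<longlongrightarrow> 0) at_top"
  shows "u r = 0"
proof -
  let ?E = "bessel_energy \<kappa> u u1"
  define K where "K = \<bar>m - 1/4\<bar> / \<kappa>"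
  have "K \<ge> 0" using assms by (simp add: K_def)
  have inv: "((\<lambda>x::real. inverse x) \<longlongrightarrow> 0) at_top"
    by (rule tendsto_inverse_0_at_top) (rule filterlim_ident)
  \<comment> \<open>This is the energy rewritten through \<open>sqrt x * u x\<close> and
    \<open>sqrt x * u1 x\<close>, the quantities whose limits are known.\<close>
  have lim_sum: "((\<lambda>x. (sqrt x * u1 x)\<^sup>2 + (sqrt x * u x) * (sqrt x * u1 x) * inverse x
      + (sqrt x * u x)\<^sup>2 * (inverse x * inverse x) * (1/4) + \<kappa>\<^sup>2 * (sqrt x * u x)\<^sup>2)
      \<longlongrightarrow> 0\<^sup>2 + 0 * 0 * 0 + 0\<^sup>2 * (0 * 0) * (1/4) + \<kappa>\<^sup>2 * 0\<^sup>2) at_top"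
    by (intro tendsto_intros lim inv)
  have sum_eq: "(sqrt x * u1 x)\<^sup>2 + (sqrt x * u x) * (sqrt x * u1 x) * inverse x
      + (sqrt x * u x)\<^sup>2 * (inverse x * inverse x) * (1/4) + \<kappa>\<^sup>2 * (sqrt x * u x)\<^sup>2 = ?E x"
    if "x > 0" for x
  proof -
    have "sqrt x * u x * (sqrt x * u1 x) = (sqrt x)\<^sup>2 * (u x * u1 x)"
      by (simp add: power2_eq_square)
    then show ?thesis
      using that unfolding bessel_energy_def power_mult_distrib
      by (simp add: field_simps power2_eq_square)
  qed
  have limE: "(?E \<longlongrightarrow> 0) at_top"
    using Lim_transform_eventually[OF lim_sum eventually_mono[OF eventually_gt_at_top sum_eq]] by simp
  have "?E r * exp (- K / r) \<le> ?E s" if "s \<ge> r" for s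
  proof -
    have "?E r * exp (- K / r) \<le> ?E s * exp (- K / s)"
      unfolding K_def by (rule bessel_energy_compare(1)[of r s \<kappa> u u1 u2 m]) (use assms that in auto)
    also have "\<dots> \<le> ?E s * 1"
      using assms that \<open>K \<ge> 0\<close> by (intro mult_left_mono bessel_energy_nonneg) auto
    finally show ?thesis by simp
  qed
  then have "?E r * exp (- K / r) \<le> 0"
    by (intro tendsto_lowerbound[OF limE] eventually_mono[OF eventually_ge_at_top[of r]]) auto
  then have "?E r \<le> 0"
    by (simp add: mult_le_0_iff not_le[symmetric])
  with bessel_energy_nonneg[of r \<kappa> u u1] assms have "?E r = 0"
    by linarith
  then show ?thesis
    using bessel_energy_eq_0 assms by blast
qed

context helmholtz_on
begin

text \<open>The energy method is for real functions. Bessel's equation has real coefficients, so the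
  real and imaginary parts of a coefficient satisfy it separately.\<close>

lemma bessel_Re_Im:
  assumes I: "open I" "convex I" "r \<in> I" and sub: "\<And>r t. r \<in> I \<Longrightarrow> p + of_real r * cis t \<in> U"
  shows "((\<lambda>r. Re (fourier_coeff f p n r)) has_real_derivative Re (fourier_coeff' f p n r)) (at r)"
    and "((\<lambda>r. Im (fourier_coeff f p n r)) has_real_derivative Im (fourier_coeff' f p n r)) (at r)"
    and "((\<lambda>r. Re (fourier_coeff' f p n r)) has_real_derivative Re (fourier_coeff'' f p n r)) (at r)"
    and "((\<lambda>r. Im (fourier_coeff' f p n r)) has_real_derivative Im (fourier_coeff'' f p n r)) (at r)"
    and "r\<^sup>2 * Re (fourier_coeff'' f p n r) + r * Re (fourier_coeff' f p n r)
      + (\<kappa>\<^sup>2 * r\<^sup>2 - (of_int n)\<^sup>2) * Re (fourier_coeff f p n r) = 0"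
    and "r\<^sup>2 * Im (fourier_coeff'' f p n r) + r * Im (fourier_coeff' f p n r)
      + (\<kappa>\<^sup>2 * r\<^sup>2 - (of_int n)\<^sup>2) * Im (fourier_coeff f p n r) = 0"
proof -
  note d = fourier_coeff_deriv[OF I sub, of n, unfolded has_vector_derivative_complex_iff]
  show "((\<lambda>r. Re (fourier_coeff f p n r)) has_real_derivative Re (fourier_coeff' f p n r)) (at r)"
    and "((\<lambda>r. Im (fourier_coeff f p n r)) has_real_derivative Im (fourier_coeff' f p n r)) (at r)"
    using d(1) by blast+
  show "((\<lambda>r. Re (fourier_coeff' f p n r)) has_real_derivative Re (fourier_coeff'' f p n r)) (at r)"
    and "((\<lambda>r. Im (fourier_coeff' f p n r)) has_real_derivative Im (fourier_coeff'' f p n r)) (at r)"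
    using d(2) by blast+
  have ode: "of_real (r\<^sup>2) * fourier_coeff'' f p n r + of_real r * fourier_coeff' f p n r
    + of_real (\<kappa>\<^sup>2 * r\<^sup>2 - (of_int n)\<^sup>2) * fourier_coeff f p n r = 0"
    by (rule bessel_ode) (rule sub[OF I(3)])
  show "r\<^sup>2 * Re (fourier_coeff'' f p n r) + r * Re (fourier_coeff' f p n r)
      + (\<kappa>\<^sup>2 * r\<^sup>2 - (of_int n)\<^sup>2) * Re (fourier_coeff f p n r) = 0"
    using arg_cong[OF ode, of Re]
    by (simp only: plus_complex.sel Re_complex_of_real Im_complex_of_real times_complex.sel zero_complex.sel mult_zero_left diff_zero)
  show "r\<^sup>2 * Im (fourier_coeff'' f p n r) + r * Im (fourier_coeff' f p n r)
      + (\<kappa>\<^sup>2 * r\<^sup>2 - (of_int n)\<^sup>2) * Im (fourier_coeff f p n r) = 0"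
    using arg_cong[OF ode, of Im]
    by (simp only: plus_complex.sel Re_complex_of_real Im_complex_of_real times_complex.sel zero_complex.sel mult_zero_left diff_zero add_0_right)
qed

lemma circle_eq_0:
  assumes sub: "\<And>t. p + of_real r * cis t \<in> U" and zero: "\<And>n. fourier_coeff f p n r = 0"
    and "norm w = 1"
  shows "f (p + of_real r * w) = 0"
proof (rule fourier_unique[where g="\<lambda>w. f (p + of_real r * w)"])
  show "continuous_on (sphere 0 1) (\<lambda>w. f (p + of_real r * w))"
  proof (rule continuous_on_compose2[OF cont])
    show "(\<lambda>w. p + of_real r * w) ` sphere 0 1 \<subseteq> U"
    proof safe
      fix w :: complex assume "w \<in> sphere 0 1"
      then have "norm w = 1" by simp
      then have "w = cis (Arg w)"
        using rcis_cmod_Arg[of w] by (simp add: rcis_def)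
      then show "p + of_real r * w \<in> U"
        using sub[of "Arg w"] by simp
    qed
  qed (intro continuous_intros)
qed (use zero assms(3) in \<open>auto simp: fourier_coeff_def\<close>)

text \<open>On a small circle around p every coefficient has zero Cauchy data, hence it vanishes on
  all larger circles in the ball.\<close>

lemma ball_eq_0:
  assumes "0 < \<kappa>" "0 < \<delta>" and sub: "ball p \<rho> \<subseteq> U" and zero: "\<And>z. z \<in> ball p \<delta> \<Longrightarrow> f z = 0"
    and z: "z \<in> ball p \<rho>"
  shows "f z = 0"
proof (cases "z \<in> ball p \<delta>")
  case False
  define s where "s = norm (z - p)"
  \<comment> \<open>The circle lies strictly inside the zero ball, so derivatives vanish on it too,
    and r > 0 keeps away from the singular point of Bessel's equation.\<close>
  define r where "r = \<delta> / 2"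
  define I where "I = {-\<rho><..<\<rho>}"
  have s: "r \<le> s" "0 < r" "s < \<rho>"
    using False z \<open>0 < \<delta>\<close> by (auto simp: s_def r_def dist_norm norm_minus_commute)
  have I: "open I" "convex I" "\<And>x. r \<le> x \<Longrightarrow> x \<le> s \<Longrightarrow> x \<in> I"
    using s by (auto simp: I_def)
  have subI: "p + of_real x * cis t \<in> U" if "x \<in> I" for x t
    using that sub by (auto simp: I_def dist_norm norm_mult subset_iff)
  have rz: "p + of_real r * cis t \<in> ball p \<delta>" for t
    using s(2) \<open>0 < \<delta>\<close> by (simp add: dist_norm norm_mult) (simp add: r_def)
  have 0: "fourier_coeff f p n r = 0" "fourier_coeff' f p n r = 0" for n
  proof -
    show "fourier_coeff f p n r = 0"
      unfolding fourier_coeff_def using zero[OF rz] by simp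
    have "dir_deriv f h w = 0" if "w \<in> ball p \<delta>" for h w
      using differentiable_cong_open(2)[of "ball p \<delta>" w "\<lambda>_. 0" f h] that zero
        dir_derivI[OF has_derivative_const] by auto
    then show "fourier_coeff' f p n r = 0"
      unfolding fourier_coeff'_def using rz by simp
  qed
  have "Re (fourier_coeff f p n s) = 0" "Im (fourier_coeff f p n s) = 0" for n
    by (rule bessel_zero_forward[OF s(2,1) \<open>0 < \<kappa>\<close> _ _ bessel_Re_Im(1,3,5)[OF I(1,2)]];
          auto intro: I subI simp: 0)
       (rule bessel_zero_forward[OF s(2,1) \<open>0 < \<kappa>\<close> _ _ bessel_Re_Im(2,4,6)[OF I(1,2)]];
          auto intro: I subI simp: 0)
  then have "fourier_coeff f p n s = 0" for n
    by (simp add: complex_eq_iff)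
  then have "f (p + of_real s * sgn (z - p)) = 0"
    using subI[of s] I(3)[of s] s by (intro circle_eq_0) (auto simp: norm_sgn s_def)
  moreover have "of_real s * sgn (z - p) = z - p"
    unfolding s_def by (rule norm_mult_sgn)
  ultimately show ?thesis by simp
qed (rule zero)

lemma unique_continuation:
  assumes "0 < \<kappa>" and C: "connected C" "open C" "C \<subseteq> U"
    and V: "open V" "V \<inter> C \<noteq> {}" "\<And>z. z \<in> V \<inter> C \<Longrightarrow> f z = 0"
    and "z \<in> C"
  shows "f z = 0"
proof -
  define N where "N = interior {z \<in> C. f z = 0}"
  \<comment> \<open>N is closed relative to C; being open as well, it is all of C or empty.\<close>
  have "C \<subseteq> N \<union> - closure N"
  proof
    fix q assume "q \<in> C"
    show "q \<in> N \<union> - closure N"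
    proof (cases "q \<in> closure N")
      case True
      \<comment> \<open>The radius 2e leaves room for a ball of radius e around a nearby point x of
        N: it stays inside C, still contains q, and zero spreads over it from x.\<close>
      obtain e where e: "e > 0" "ball q (2 * e) \<subseteq> C"
        using \<open>open C\<close> \<open>q \<in> C\<close> unfolding open_contains_ball
        by (metis field_sum_of_halves half_gt_zero mult_2)
      obtain x where x: "x \<in> N" "dist x q < e"
        using True \<open>e > 0\<close> closure_approachable by blast
      then obtain d where d: "d > 0" "ball x d \<subseteq> {z \<in> C. f z = 0}"
        unfolding N_def mem_interior by blast
      have sub: "ball x e \<subseteq> ball q (2 * e)"
      proof
        fix y assume "y \<in> ball x e"
        then show "y \<in> ball q (2 * e)"
          using x dist_triangle[of q y x] by (simp add: dist_commute)
      qed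
      have "f y = 0" if "y \<in> ball x e" for y
      proof (rule ball_eq_0[OF \<open>0 < \<kappa>\<close> d(1) _ _ that])
        show "ball x e \<subseteq> U" using sub e(2) C(3) by blast
        show "f z = 0" if "z \<in> ball x d" for z using d(2) that by blast
      qed
      then have "ball x e \<subseteq> {z \<in> C. f z = 0}"
        using sub e by auto
      then have "ball x e \<subseteq> N"
        unfolding N_def by (simp add: interior_maximal)
      moreover have "q \<in> ball x e" using x by simp
      ultimately show ?thesis by blast
    qed simp
  qed
  then have "N \<inter> C = {} \<or> (- closure N) \<inter> C = {}"
    using C(1) by (intro connectedD) (use closure_subset[of N] in \<open>auto simp: N_def\<close>)
  moreover have "V \<inter> C \<subseteq> N"
    unfolding N_def using V C by (intro interior_maximal) auto
  ultimately have "C \<subseteq> N"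
    using V(2) \<open>C \<subseteq> N \<union> - closure N\<close> by blast
  then show ?thesis
    using \<open>z \<in> C\<close> interior_subset unfolding N_def by blast
qed

end

section \<open>Decay of Fourier coefficients at infinity and Rellich's lemma\<close>

lemma tendsto_fourier_integral:
  assumes lim: "uniform_limit (sphere 0 1) (\<lambda>r w. of_real (sqrt r) * g r w) (\<lambda>_. 0) at_top"
    and cont: "\<forall>\<^sub>F r in at_top. continuous_on {0..2*pi} (\<lambda>t. g r (cis t))"
  shows "((\<lambda>r. of_real (sqrt r) * integral {0..2*pi} (\<lambda>t. g r (cis t) * cis (of_int n * t))) \<longlongrightarrow> (0::complex)) at_top"
proof (rule tendstoI)
  fix e :: real assume "e > 0"
  \<comment> \<open>The interval has length 2 pi < 8, so the integral of a function bounded by d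
    stays below e.\<close>
  define d where "d = e / 8"
  have "d > 0" using \<open>e > 0\<close> by (simp add: d_def)
  from lim[unfolded uniform_limit_iff, rule_format, OF this] cont
  show "\<forall>\<^sub>F r in at_top. dist (of_real (sqrt r) * integral {0..2*pi} (\<lambda>t. g r (cis t) * cis (of_int n * t))) 0 < e"
  proof eventually_elim
    case (elim r)
    have "of_real (sqrt r) * integral {0..2*pi} (\<lambda>t. g r (cis t) * cis (of_int n * t))
      = integral {0..2*pi} (\<lambda>t. of_real (sqrt r) * g r (cis t) * cis (of_int n * t))"
      by (simp add: mult.assoc)
    also have "norm \<dots> \<le> d * (2 * pi - 0)"
    proof (rule integral_bound)
      show "norm (of_real (sqrt r) * g r (cis t) * cis (of_int n * t)) \<le> d" for t
        using elim(1)[rule_format, of "cis t"] by (simp add: norm_mult)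
    qed (auto intro!: continuous_intros elim(2))
    also have "\<dots> < e"
      using pi_less_4 \<open>e > 0\<close> by (simp add: d_def)
    finally show ?case by simp
  qed
qed

context helmholtz_on
begin

lemma fourier_coeff_decay:
  assumes "0 < \<kappa>" "0 \<le> R" and sub: "\<And>z. R < norm z \<Longrightarrow> z \<in> U"
    and lim: "((\<lambda>r. of_real (sqrt r) * fourier_coeff f 0 n r) \<longlongrightarrow> 0) at_top"
      "((\<lambda>r. of_real (sqrt r) * fourier_coeff' f 0 n r) \<longlongrightarrow> 0) at_top"
    and "R < r"
  shows "fourier_coeff f 0 n r = 0"
proof -
  define I where "I = {R<..}"
  have I: "open I" "convex I" "\<And>x. x \<ge> r \<Longrightarrow> x \<in> I"
    using \<open>R < r\<close> by (auto simp: I_def)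
  have subI: "0 + of_real x * cis t \<in> U" if "x \<in> I" for x t
    using that \<open>0 \<le> R\<close> by (intro sub) (auto simp: I_def norm_mult)
  have "r > 0" using assms by simp
  have "Re (fourier_coeff f 0 n r) = 0"
    using lim[THEN tendsto_Re]
    by (intro bessel_decay_zero[OF \<open>r > 0\<close> \<open>0 < \<kappa>\<close> bessel_Re_Im(1,3,5)[of I]]) (use I subI in auto)
  moreover have "Im (fourier_coeff f 0 n r) = 0"
    using lim[THEN tendsto_Im]
    by (intro bessel_decay_zero[OF \<open>r > 0\<close> \<open>0 < \<kappa>\<close> bessel_Re_Im(2,4,6)[of I]]) (use I subI in auto)
  ultimately show ?thesis
    by (simp add: complex_eq_iff)
qed

lemma exterior_eq_0:
  assumes "0 \<le> R" and sub: "\<And>z. R < norm z \<Longrightarrow> z \<in> U"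
    and zero: "\<And>n r. R < r \<Longrightarrow> fourier_coeff f 0 n r = 0" and "R < norm z"
  shows "f z = 0"
proof -
  have "f (0 + of_real (norm z) * sgn z) = 0"
    using assms by (intro circle_eq_0 sub) (auto simp: norm_mult norm_sgn)
  then show ?thesis
    by (simp add: norm_mult_sgn)
qed

text \<open>Both f and its radial derivative are required to be o(1/sqrt r), because both enter the
  energy of each coefficient.\<close>

theorem rellich:
  assumes "0 < \<kappa>" "0 \<le> R" and sub: "\<And>z. R < norm z \<Longrightarrow> z \<in> U"
    and "uniform_limit (sphere 0 1) (\<lambda>r w. of_real (sqrt r) * f (of_real r * w)) (\<lambda>_. 0) at_top"
    and "uniform_limit (sphere 0 1) (\<lambda>r w. of_real (sqrt r) * dir_deriv f w (of_real r * w)) (\<lambda>_. 0) at_top"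
    and "R < norm z"
  shows "f z = 0"
proof -
  have sub': "0 + of_real r * cis t \<in> U" if "R < r" for r t
    using that \<open>0 \<le> R\<close> by (intro sub) (simp add: norm_mult)
  have *: "\<forall>\<^sub>F r in at_top. continuous_on {0..2*pi} (\<lambda>t. f (of_real r * cis t))"
    "\<forall>\<^sub>F r in at_top. continuous_on {0..2*pi} (\<lambda>t. dir_deriv f (cis t) (of_real r * cis t))"
    using continuous_polar(1,2)[where S="{0..2*pi}" and p=0 and R="\<lambda>_. r" and T="\<lambda>t. t" for r] sub'
    by (auto intro!: eventually_mono[OF eventually_gt_at_top[of R]] continuous_intros)
  show ?thesis
    using tendsto_fourier_integral[OF assms(4) *(1)] tendsto_fourier_integral[OF assms(5) *(2)] assms
    by (intro exterior_eq_0[OF assms(2) sub fourier_coeff_decay[OF assms(1,2) sub]])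
       (auto simp: fourier_coeff_def fourier_coeff'_def)
qed

end

subsection \<open>Entire radiating solutions and a gradient estimate\<close>

text \<open>The center p is a parameter: after the change of coordinates the given condition is
  centered at the preimage of the original origin, which may lie off the real axis.\<close>

definition radiating :: "real \<Rightarrow> complex \<Rightarrow> (complex \<Rightarrow> complex) \<Rightarrow> bool" where
  "radiating \<kappa> p f \<longleftrightarrow> uniform_limit (sphere 0 1)
     (\<lambda>r w. of_real (sqrt r) *
        (dir_deriv f w (p + of_real r * w) - \<i> * of_real \<kappa> * f (p + of_real r * w)))
     (\<lambda>_. 0) at_top"

text \<open>The Wronskian of the real and imaginary parts of a Fourier coefficient \<open>c\<close> vanishes at the
  center, hence everywhere. Together with \<open>c' = i \<kappa> c + o(1/\<surd>r)\<close> this forces \<open>c = o(1/\<surd>r)\<close>.\<close>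

lemma entire_radiating_eq_0:
  assumes "helmholtz \<kappa> UNIV f" "0 < \<kappa>" and rad: "radiating \<kappa> 0 f" and "z \<noteq> 0"
  shows "f z = 0"
proof -
  interpret helmholtz_on \<kappa> UNIV f by standard fact
  have coeff: "fourier_coeff f 0 n r = 0" if "0 < r" for n r
  proof (rule fourier_coeff_decay[OF \<open>0 < \<kappa>\<close> order_refl _ _ _ that])
    define c c' where "c = fourier_coeff f 0 n" and "c' = fourier_coeff' f 0 n"
    define e where "e r = c' r - \<i> * of_real \<kappa> * c r" for r
    have "e r = integral {0..2*pi} (\<lambda>t. (dir_deriv f (cis t) (0 + of_real r * cis t)
        - \<i> * of_real \<kappa> * f (0 + of_real r * cis t)) * cis (of_int n * t))" for r
    proof -
      have "((\<lambda>t. dir_deriv f (cis t) (0 + of_real r * cis t) * cis (of_int n * t)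
          - \<i> * of_real \<kappa> * (f (0 + of_real r * cis t) * cis (of_int n * t))) has_integral e r) {0..2*pi}"
        unfolding e_def c_def c'_def fourier_coeff_def fourier_coeff'_def
        by (intro has_integral_diff has_integral_mult_right integrable_integral integrable_polar) auto
      then show ?thesis
        by (simp add: integral_unique algebra_simps)
    qed
    moreover have "((\<lambda>r. of_real (sqrt r) * integral {0..2*pi} (\<lambda>t. (dir_deriv f (cis t) (0 + of_real r * cis t)
        - \<i> * of_real \<kappa> * f (0 + of_real r * cis t)) * cis (of_int n * t))) \<longlongrightarrow> 0) at_top"
      by (rule tendsto_fourier_integral[OF rad[unfolded radiating_def]],
          intro always_eventually allI continuous_intros continuous_polar) auto
    ultimately have e: "((\<lambda>r. of_real (sqrt r) * e r) \<longlongrightarrow> 0) at_top"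
      by simp
    have wronskian: "Re (c r) * Im (c' r) = Im (c r) * Re (c' r)" if "r > 0" for r
    proof -
      \<comment> \<open>Abel's identity for Bessel's equation: r times the Wronskian is constant.
        The factor r makes this constant zero at the center.\<close>
      define W where "W r = r * (Re (c r) * Im (c' r) - Im (c r) * Re (c' r))" for r
      note d = bessel_Re_Im[of UNIV _ 0 n, simplified, folded c_def c'_def]
      have dW: "(W has_real_derivative 0) (at x)" if "x > 0" for x
      proof -
        let ?c'' = "fourier_coeff'' f 0 n x"
        have "(W has_real_derivative
            (Re (c x) * Im (c' x) - Im (c x) * Re (c' x))
            + x * (Re (c x) * Im ?c'' - Im (c x) * Re ?c'')) (at x)"
          unfolding W_def[abs_def]
          by (rule derivative_eq_intros d refl | simp)+
        also have "(Re (c x) * Im (c' x) - Im (c x) * Re (c' x))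
            + x * (Re (c x) * Im ?c'' - Im (c x) * Re ?c'')
            = (Re (c x) * (x\<^sup>2 * Im ?c'' + x * Im (c' x) + (\<kappa>\<^sup>2 * x\<^sup>2 - (of_int n)\<^sup>2) * Im (c x))
              - Im (c x) * (x\<^sup>2 * Re ?c'' + x * Re (c' x) + (\<kappa>\<^sup>2 * x\<^sup>2 - (of_int n)\<^sup>2) * Re (c x))) / x"
          using that by (simp add: field_simps power2_eq_square)
        also have "\<dots> = 0"
          unfolding d(5,6) by simp
        finally show ?thesis .
      qed
      \<comment> \<open>The derivative of W was computed by dividing by x, so it is known only for
        positive radii; continuity carries the constancy down to 0.\<close>
      have "continuous_on {0..r} W"
        unfolding W_def[abs_def]
        by (intro continuous_intros continuous_at_imp_continuous_on ballI) (use d(1-4)[THEN DERIV_isCont] in auto)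
      with DERIV_isconst_end[OF \<open>r > 0\<close> this] dW have "W r = W 0" by blast
      then show ?thesis
        using \<open>r > 0\<close> by (simp add: W_def)
    qed
    \<comment> \<open>Inserting c' = e + i \<kappa> c into the vanishing Wronskian gives \<kappa>
      |c|^2 = - Im (e cnj c), and one factor |c| cancels.\<close>
    have bound: "norm (c r) \<le> norm (e r) / \<kappa>" if "r > 0" for r
    proof -
      have "c' r = e r + \<i> * of_real \<kappa> * c r" by (simp add: e_def)
      then have "Re (c r) * (Im (e r) + \<kappa> * Re (c r)) = Im (c r) * (Re (e r) - \<kappa> * Im (c r))"
        using wronskian[OF that] by simp
      then have "\<kappa> * ((Re (c r))\<^sup>2 + (Im (c r))\<^sup>2) = - Im (e r * cnj (c r))"
        by (simp add: algebra_simps power2_eq_square)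
      also have "\<dots> \<le> norm (e r * cnj (c r))"
        using abs_Im_le_cmod[of "e r * cnj (c r)"] by linarith
      finally have "\<kappa> * (norm (c r))\<^sup>2 \<le> norm (e r) * norm (c r)"
        by (simp add: cmod_power2 norm_mult)
      then have "(\<kappa> * norm (c r)) * norm (c r) \<le> norm (e r) * norm (c r)"
        by (simp add: power2_eq_square algebra_simps)
      then have "\<kappa> * norm (c r) \<le> norm (e r)"
        by (cases "c r = 0") (auto simp: mult_le_cancel_right)
      then show ?thesis
        using \<open>0 < \<kappa>\<close> by (simp add: field_simps)
    qed
    show c: "((\<lambda>r. of_real (sqrt r) * fourier_coeff f 0 n r) \<longlongrightarrow> 0) at_top"
      unfolding c_def[symmetric]
    proof (rule Lim_null_comparison)
      show "\<forall>\<^sub>F r in at_top. norm (of_real (sqrt r) * c r) \<le> norm (of_real (sqrt r) * e r) / \<kappa>"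
        using eventually_gt_at_top[of "0::real"]
      proof eventually_elim
        case (elim r)
        then show ?case
          using mult_left_mono[OF bound[OF elim], of "sqrt r"] by (simp add: norm_mult)
      qed
      show "((\<lambda>r. norm (of_real (sqrt r) * e r) / \<kappa>) \<longlongrightarrow> 0) at_top"
        using tendsto_divide[OF tendsto_norm[OF e] tendsto_const[of \<kappa>]] \<open>0 < \<kappa>\<close> by simp
    qed
    have "((\<lambda>r. of_real (sqrt r) * e r + \<i> * of_real \<kappa> * (of_real (sqrt r) * c r)) \<longlongrightarrow> 0) at_top"
      using tendsto_add[OF e tendsto_mult_left[OF c[folded c_def], of "\<i> * of_real \<kappa>"]] by simp
    then show "((\<lambda>r. of_real (sqrt r) * fourier_coeff' f 0 n r) \<longlongrightarrow> 0) at_top"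
      unfolding c'_def[symmetric] by (simp add: e_def algebra_simps)
  qed simp
  show ?thesis
    by (rule exterior_eq_0[OF order_refl _ coeff]) (use \<open>z \<noteq> 0\<close> in auto)
qed

section \<open>Interior gradient estimate from the first Fourier modes\<close>

context helmholtz_on
begin

lemma fourier_coeff_bound:
  assumes "\<And>t. p + of_real r * cis t \<in> U" "\<And>t. norm (f (p + of_real r * cis t)) \<le> M"
  shows "norm (fourier_coeff f p n r) \<le> 2 * pi * M"
proof -
  have "norm (fourier_coeff f p n r) \<le> M * (2 * pi - 0)"
    unfolding fourier_coeff_def
  proof (rule integral_bound)
    show "continuous_on {0..2*pi} (\<lambda>t. f (p + of_real r * cis t) * cis (of_int n * t))"
      by (intro continuous_intros continuous_polar assms)
  qed (use assms in \<open>auto simp: norm_mult\<close>)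
  then show ?thesis by (simp add: algebra_simps)
qed

text \<open>For \<open>n = \<plusminus>1\<close> Bessel's equation reads \<open>(r\<^sup>3 (c/r)')' = - \<kappa>\<^sup>2 r\<^sup>2 c\<close>, which controls the
  derivative of \<open>c/r\<close>; the limit of \<open>c/r\<close> at the center is \<open>c'(0)\<close>.\<close>

lemma fourier_coeff'_center_bound:
  assumes n: "n\<^sup>2 = 1" and sub: "ball p 2 \<subseteq> U" and M: "\<And>z. z \<in> ball p 2 \<Longrightarrow> norm (f z) \<le> M"
  shows "norm (fourier_coeff' f p n 0) \<le> 2 * pi * (1 + \<kappa>\<^sup>2) * M"
proof -
  define c c' c'' where "c = fourier_coeff f p n" and "c' = fourier_coeff' f p n" and "c'' = fourier_coeff'' f p n"
  have in_ball: "p + of_real r * cis t \<in> ball p 2" if "\<bar>r\<bar> < 2" for r t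
    using that by (simp add: dist_norm norm_mult)
  have "norm (f p) \<le> M"
    using M by simp
  then have "M \<ge> 0"
    using norm_ge_zero order_trans by blast
  have sub': "p + of_real r * cis t \<in> U" if "\<bar>r\<bar> < 2" for r t
    using in_ball[OF that] sub by blast
  have c_bound: "norm (c r) \<le> 2 * pi * M" if "\<bar>r\<bar> < 2" for r
    unfolding c_def by (rule fourier_coeff_bound) (use sub' M in_ball that in auto)
  define B where "B = \<kappa>\<^sup>2 * (2 * pi * M)"
  have "B \<ge> 0" using \<open>M \<ge> 0\<close> by (simp add: B_def)
  have d: "(c has_vector_derivative c' r) (at r)" "(c' has_vector_derivative c'' r) (at r)" if "\<bar>r\<bar> < 2" for r
    using fourier_coeff_deriv[of "ball 0 2" r p n] sub' that unfolding c_def c'_def c''_def by auto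
  have ode: "of_real (r\<^sup>2) * c'' r + of_real r * c' r - c r = - of_real (\<kappa>\<^sup>2 * r\<^sup>2) * c r" if "\<bar>r\<bar> < 2" for r
  proof -
    have "(of_int n)\<^sup>2 = (1::real)" using n by (metis of_int_1 of_int_power)
    then show ?thesis
      using bessel_ode[OF sub'[OF that], of n] unfolding c_def c'_def c''_def
      by (simp add: algebra_simps)
  qed
  \<comment> \<open>For n = 1 and n = -1 the equation at r = 0 reduces to - c 0 = 0.\<close>
  have "c 0 = 0"
    using ode[of 0] by simp
  \<comment> \<open>This is r^3 (c/r)' written without division, so it makes sense at 0 and vanishes
    there. Its derivative is at most B r^2 in norm, hence G is at most B r^3 on [0,1].\<close>
  define G where "G r = of_real (r\<^sup>2) * c' r - of_real r * c r" for r
  have dG: "(G has_vector_derivative - of_real (\<kappa>\<^sup>2 * r\<^sup>2) * c r) (at r)" if "\<bar>r\<bar> < 2" for r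
  proof -
    have "(G has_vector_derivative (of_real (r\<^sup>2) * c'' r + of_real (2 * r) * c' r)
        - (of_real r * c' r + of_real 1 * c r)) (at r)"
      unfolding G_def[abs_def]
      by (intro has_vector_derivative_diff has_vector_derivative_mult d that
          has_vector_derivative_of_real) (auto intro!: derivative_eq_intros)
    moreover have "(of_real (r\<^sup>2) * c'' r + of_real (2 * r) * c' r)
        - (of_real r * c' r + of_real 1 * c r) = - of_real (\<kappa>\<^sup>2 * r\<^sup>2) * c r"
      unfolding ode[OF that, symmetric] by simp
    ultimately show ?thesis by simp
  qed
  have G: "norm (G r) \<le> B * r ^ 3" if "0 \<le> r" "r \<le> 1" for r
  proof -
    have "((\<lambda>r. - of_real (\<kappa>\<^sup>2 * r\<^sup>2) * c r) has_integral G r - G 0) {0..r}"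
      using that by (intro fundamental_theorem_of_calculus has_vector_derivative_at_within[OF dG]) auto
    then have "norm (G r - G 0) \<le> (B * r\<^sup>2) * measure lborel {0..r}"
    proof (rule has_integral_bound[rotated, where 'a=real, unfolded cbox_interval])
      show "norm (- of_real (\<kappa>\<^sup>2 * s\<^sup>2) * c s) \<le> B * r\<^sup>2" if s: "s \<in> {0..r}" for s
      proof -
        have "norm (- of_real (\<kappa>\<^sup>2 * s\<^sup>2) * c s) = \<kappa>\<^sup>2 * (s\<^sup>2 * norm (c s))"
          by (simp add: norm_mult norm_power)
        also have "\<dots> \<le> \<kappa>\<^sup>2 * (r\<^sup>2 * (2 * pi * M))"
          using s \<open>r \<le> 1\<close> by (intro mult_left_mono mult_mono c_bound power_mono) auto
        finally show ?thesis by (simp add: B_def algebra_simps)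
      qed
    qed (use \<open>B \<ge> 0\<close> in auto)
    then show ?thesis
      using that by (simp add: G_def power3_eq_cube power2_eq_square mult.assoc)
  qed
  have quot: "norm (c r) \<le> (2 * pi * M + B) * r" if "0 < r" "r < 1" for r
  proof -
    \<comment> \<open>The derivative of h is G / s^3, bounded by B; integrating inward from s = 1,
      where h is bounded by 2 pi M, bounds h uniformly as r tends to 0.\<close>
    define h where "h r = of_real (1 / r) * c r" for r
    have dh: "(h has_vector_derivative of_real (1 / s ^ 3) * G s) (at s)" if "0 < s" "s \<le> 1" for s
    proof -
      have "(h has_vector_derivative of_real (1 / s) * c' s + of_real (- (1 / s\<^sup>2)) * c s) (at s)"
        unfolding h_def[abs_def] using that
        by (intro has_vector_derivative_mult d has_vector_derivative_of_real)
           (auto intro!: derivative_eq_intros simp: power2_eq_square)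
      moreover have "of_real (1 / s) * c' s + of_real (- (1 / s\<^sup>2)) * c s = of_real (1 / s ^ 3) * G s"
        using that by (simp add: G_def field_simps power2_eq_square power3_eq_cube)
      ultimately show ?thesis by simp
    qed
    have "((\<lambda>s. of_real (1 / s ^ 3) * G s) has_integral h 1 - h r) {r..1}"
      using that by (intro fundamental_theorem_of_calculus has_vector_derivative_at_within[OF dh]) auto
    then have "norm (h 1 - h r) \<le> B * measure lborel {r..1}"
    proof (rule has_integral_bound[rotated, where 'a=real, unfolded cbox_interval])
      show "norm (of_real (1 / s ^ 3) * G s) \<le> B" if s: "s \<in> {r..1}" for s
      proof -
        have "s > 0" using s \<open>0 < r\<close> by simp
        then have "norm (of_real (1 / s ^ 3) * G s) = norm (G s) / s ^ 3"
          by (simp add: norm_mult norm_divide norm_power)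
        also have "\<dots> \<le> B"
          using G[of s] s \<open>s > 0\<close> by (simp add: field_simps)
        finally show ?thesis .
      qed
    qed (use \<open>B \<ge> 0\<close> in auto)
    also have "\<dots> \<le> B"
      using that \<open>B \<ge> 0\<close> by (simp add: mult_left_le)
    finally have "norm (h r) \<le> norm (h 1) + B"
      using norm_triangle_ineq2[of "h r" "h 1"] by (simp add: norm_minus_commute)
    moreover have "norm (h 1) \<le> 2 * pi * M"
      unfolding h_def using c_bound[of 1] by simp
    ultimately have "norm (h r) \<le> 2 * pi * M + B"
      by simp
    then show ?thesis
      using that by (simp add: h_def norm_mult norm_divide field_simps)
  qed
  have "norm (c' 0) \<le> 2 * pi * M + B"
  proof (rule field_le_epsilon)
    fix e :: real assume "e > 0"
    then obtain \<delta> where \<delta>: "\<delta> > 0" "\<And>y. \<bar>y\<bar> < \<delta> \<Longrightarrow> norm (c y - c 0 - y *\<^sub>R c' 0) \<le> e * \<bar>y\<bar>"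
      using d(1)[of 0] unfolding has_vector_derivative_def has_derivative_at_alt by fastforce
    define r where "r = min (\<delta> / 2) (1 / 2)"
    have r: "0 < r" "r < 1" "r < \<delta>" using \<open>\<delta> > 0\<close> by (auto simp: r_def min_def)
    have "r * norm (c' 0) = norm (c r - (c r - c 0 - r *\<^sub>R c' 0))"
      using r \<open>c 0 = 0\<close> by simp
    also have "\<dots> \<le> norm (c r) + norm (c r - c 0 - r *\<^sub>R c' 0)"
      by (rule norm_triangle_ineq4)
    also have "\<dots> \<le> (2 * pi * M + B) * r + e * r"
      using quot[OF r(1,2)] \<delta>(2)[of r] r by (intro add_mono) auto
    finally have "r * norm (c' 0) \<le> r * (2 * pi * M + B + e)"
      by (simp add: algebra_simps)
    then show "norm (c' 0) \<le> 2 * pi * M + B + e"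
      using r by simp
  qed
  then show ?thesis
    by (simp add: c'_def B_def algebra_simps)
qed

text \<open>At the center the modes 1 and -1 of the radial derivative are pi (P + iQ) and pi (P -
  iQ), so they determine the gradient. The bound is linear in M, and hence passes the growth rate of
  f on to its gradient.\<close>

lemma gradient_bound:
  assumes sub: "ball p 2 \<subseteq> U" and M: "\<And>z. z \<in> ball p 2 \<Longrightarrow> norm (f z) \<le> M"
  shows "norm (dir_deriv f h p) \<le> 4 * (1 + \<kappa>\<^sup>2) * M * norm h"
proof -
  have "p \<in> U" using sub by auto
  define P Q where "P = dir_deriv f 1 p" and "Q = dir_deriv f \<i> p"
  have "fourier_coeff' f p n 0 = integral {0..2*pi} (\<lambda>t. (P - \<i> * Q) / 2 * cis (of_int (n + 1) * t)
      + (P + \<i> * Q) / 2 * cis (of_int (n - 1) * t))" for n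
  proof -
    have "dir_deriv f (cis t) p * cis (of_int n * t) = (P - \<i> * Q) / 2 * cis (of_int (n + 1) * t)
      + (P + \<i> * Q) / 2 * cis (of_int (n - 1) * t)" for t
    proof -
      have "cis (of_int (n + 1) * t) = cis t * cis (of_int n * t)"
        "cis (of_int (n - 1) * t) = cis (- t) * cis (of_int n * t)"
        by (auto simp: cis_mult algebra_simps)
      moreover have "dir_deriv f (cis t) p = (P - \<i> * Q) / 2 * cis t + (P + \<i> * Q) / 2 * cis (- t)"
        unfolding dir_deriv_expand[OF \<open>p \<in> U\<close>, of "cis t"] P_def[symmetric] Q_def[symmetric]
        by (simp add: complex_eq_iff field_simps)
      ultimately show ?thesis
        by (simp add: algebra_simps)
    qed
    then show ?thesis
      by (simp add: fourier_coeff'_def)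
  qed
  also have "integral {0..2*pi} (\<lambda>t. (P - \<i> * Q) / 2 * cis (of_int (n + 1) * t)
      + (P + \<i> * Q) / 2 * cis (of_int (n - 1) * t))
      = (P - \<i> * Q) / 2 * integral {0..2*pi} (\<lambda>t. cis (of_int (n + 1) * t))
      + (P + \<i> * Q) / 2 * integral {0..2*pi} (\<lambda>t. cis (of_int (n - 1) * t))" for n
    by (intro integral_unique has_integral_add has_integral_mult_right integrable_integral
        integrable_continuous_interval continuous_intros)
  finally have coeff: "fourier_coeff' f p n 0 = (P - \<i> * Q) / 2 * (if n + 1 = 0 then 2 * pi else 0)
      + (P + \<i> * Q) / 2 * (if n - 1 = 0 then 2 * pi else 0)" for n
    unfolding integral_cis_of_int .
  have coeff': "fourier_coeff' f p 1 0 = of_real pi * (P + \<i> * Q)"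
    "fourier_coeff' f p (-1) 0 = of_real pi * (P - \<i> * Q)"
    unfolding coeff by simp_all
  have "norm (fourier_coeff' f p 1 0) \<le> 2 * pi * (1 + \<kappa>\<^sup>2) * M"
    "norm (fourier_coeff' f p (-1) 0) \<le> 2 * pi * (1 + \<kappa>\<^sup>2) * M"
    by (intro fourier_coeff'_center_bound sub M; simp)+
  then have "pi * norm (P + \<i> * Q) \<le> pi * (2 * (1 + \<kappa>\<^sup>2) * M)" "pi * norm (P - \<i> * Q) \<le> pi * (2 * (1 + \<kappa>\<^sup>2) * M)"
    unfolding coeff' by (simp_all add: norm_mult mult_ac)
  then have b: "norm (P + \<i> * Q) \<le> 2 * (1 + \<kappa>\<^sup>2) * M" "norm (P - \<i> * Q) \<le> 2 * (1 + \<kappa>\<^sup>2) * M"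
    by (simp_all only: mult_le_cancel_left_pos pi_gt_zero)
  have "norm ((P + \<i> * Q) + (P - \<i> * Q)) \<le> 2 * (2 * (1 + \<kappa>\<^sup>2) * M)"
    using norm_triangle_ineq[of "P + \<i> * Q" "P - \<i> * Q"] b by linarith
  then have P: "norm P \<le> 2 * (1 + \<kappa>\<^sup>2) * M"
    by (simp add: norm_mult mult_2[symmetric])
  have "norm ((P + \<i> * Q) - (P - \<i> * Q)) \<le> 2 * (2 * (1 + \<kappa>\<^sup>2) * M)"
    using norm_triangle_ineq4[of "P + \<i> * Q" "P - \<i> * Q"] b by linarith
  then have Q: "norm Q \<le> 2 * (1 + \<kappa>\<^sup>2) * M"
    by (simp add: norm_mult mult_2[symmetric])
  have "norm (dir_deriv f h p) \<le> \<bar>Re h\<bar> * norm P + \<bar>Im h\<bar> * norm Q"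
    unfolding dir_deriv_expand[OF \<open>p \<in> U\<close>, of h] P_def[symmetric] Q_def[symmetric]
    using norm_triangle_ineq[of "of_real (Re h) * P" "of_real (Im h) * Q"] by (simp add: norm_mult)
  also have "\<dots> \<le> norm h * (2 * (1 + \<kappa>\<^sup>2) * M) + norm h * (2 * (1 + \<kappa>\<^sup>2) * M)"
    using P Q by (intro add_mono mult_mono abs_Re_le_cmod abs_Im_le_cmod) auto
  finally show ?thesis by (simp add: algebra_simps)
qed

end

subsection \<open>Operations on solutions\<close>

lemma helmholtz_open: "helmholtz \<kappa> U f \<Longrightarrow> open U"
  by (simp add: helmholtz_def)

lemma helmholtz_subset:
  assumes "helmholtz \<kappa> U f" "open V" "V \<subseteq> U"
  shows "helmholtz \<kappa> V f"
  using assms continuous_on_subset[OF _ \<open>V \<subseteq> U\<close>] unfolding helmholtz_def by blast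

text \<open>Being a solution is a local property; this glues the reflected function from its
  pieces.\<close>

lemma helmholtz_Union:
  assumes "\<And>V. V \<in> \<V> \<Longrightarrow> helmholtz \<kappa> V f"
  shows "helmholtz \<kappa> (\<Union>\<V>) f"
proof -
  have "continuous_on (\<Union>\<V>) (dir_deriv (dir_deriv f h) k)" for h k
    using assms by (intro continuous_on_open_Union) (auto simp: helmholtz_def)
  moreover have "open (\<Union>\<V>)"
    using assms by (auto simp: helmholtz_def)
  ultimately show ?thesis
    using assms unfolding helmholtz_def by blast
qed

lemma helmholtz_cong:
  assumes "helmholtz \<kappa> U f" "\<And>z. z \<in> U \<Longrightarrow> g z = f z"
  shows "helmholtz \<kappa> U g"
proof -
  interpret helmholtz_on \<kappa> U f by standard fact
  show ?thesis
  proof (rule helmholtzI[OF open_U])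
    show "(g has_derivative (\<lambda>h. dir_deriv f h z)) (at z)" if "z \<in> U" for z
      by (rule has_derivative_transform_within_open[OF has_deriv open_U]) (use that assms(2) in auto)
    show "(dir_deriv f h has_derivative (\<lambda>k. dir_deriv (dir_deriv f h) k z)) (at z)"
      if "z \<in> U" for z h
      using that by (rule has_deriv2)
    show "continuous_on U (dir_deriv (dir_deriv f h) k)" for h k
      by (rule cont2)
    show "dir_deriv (dir_deriv f 1) 1 z + dir_deriv (dir_deriv f \<i>) \<i> z + of_real (\<kappa>\<^sup>2) * g z = 0"
      if "z \<in> U" for z
      using equation[OF that] assms(2)[OF that] by simp
  qed
qed

lemma helmholtz_add:
  assumes "helmholtz \<kappa> U f" "helmholtz \<kappa> U g"
  shows "helmholtz \<kappa> U (\<lambda>z. f z + g z)"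
proof -
  interpret f: helmholtz_on \<kappa> U f by standard fact
  interpret g: helmholtz_on \<kappa> U g by standard fact
  show ?thesis
  proof (rule helmholtzI[OF f.open_U])
    show "((\<lambda>z. f z + g z) has_derivative (\<lambda>h. dir_deriv f h z + dir_deriv g h z)) (at z)"
      if "z \<in> U" for z
      using that by (intro has_derivative_add f.has_deriv g.has_deriv)
    show "((\<lambda>z. dir_deriv f h z + dir_deriv g h z) has_derivative
        (\<lambda>k. dir_deriv (dir_deriv f h) k z + dir_deriv (dir_deriv g h) k z)) (at z)"
      if "z \<in> U" for z h
      using that by (intro has_derivative_add f.has_deriv2 g.has_deriv2)
    show "continuous_on U (\<lambda>z. dir_deriv (dir_deriv f h) k z + dir_deriv (dir_deriv g h) k z)" for h k
      by (intro continuous_intros f.cont2 g.cont2)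
    show "dir_deriv (dir_deriv f 1) 1 z + dir_deriv (dir_deriv g 1) 1 z
      + (dir_deriv (dir_deriv f \<i>) \<i> z + dir_deriv (dir_deriv g \<i>) \<i> z)
      + of_real (\<kappa>\<^sup>2) * (f z + g z) = 0" if "z \<in> U" for z
      using f.equation[OF that] g.equation[OF that] by (simp add: algebra_simps)
  qed
qed

text \<open>L is linear over the reals only, so that it may be the imaginary part; it respects the
  equation because \<kappa>^2 is real.\<close>

lemma helmholtz_linear:
  assumes "helmholtz \<kappa> U f" and L: "bounded_linear L"
  shows "helmholtz \<kappa> U (\<lambda>z. L (f z))"
proof -
  interpret helmholtz_on \<kappa> U f by standard fact
  interpret L: bounded_linear L by fact
  show ?thesis
  proof (rule helmholtzI[OF open_U])
    show "((\<lambda>z. L (f z)) has_derivative (\<lambda>h. L (dir_deriv f h z))) (at z)" if "z \<in> U" for z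
      using that by (intro L.has_derivative has_deriv)
    show "((\<lambda>z. L (dir_deriv f h z)) has_derivative (\<lambda>k. L (dir_deriv (dir_deriv f h) k z))) (at z)"
      if "z \<in> U" for z h
      using that by (intro L.has_derivative has_deriv2)
    show "continuous_on U (\<lambda>z. L (dir_deriv (dir_deriv f h) k z))" for h k
      by (intro L.continuous_on cont2)
    show "L (dir_deriv (dir_deriv f 1) 1 z) + L (dir_deriv (dir_deriv f \<i>) \<i> z)
      + of_real (\<kappa>\<^sup>2) * L (f z) = 0" if "z \<in> U" for z
    proof -
      have "L (dir_deriv (dir_deriv f 1) 1 z) + L (dir_deriv (dir_deriv f \<i>) \<i> z)
          = L (- (\<kappa>\<^sup>2 *\<^sub>R f z))"
        unfolding L.add[symmetric] equation[OF that] by (simp add: scaleR_conv_of_real)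
      then show ?thesis
        by (simp only: linear_neg[OF L.linear] L.scaleR) (simp add: scaleR_conv_of_real)
    qed
  qed
qed

lemma helmholtz_cnj:
  assumes "helmholtz \<kappa> U f"
  shows "helmholtz \<kappa> (cnj -` U) (\<lambda>z. f (cnj z))"
proof -
  interpret helmholtz_on \<kappa> U f by standard fact
  have *: "((\<lambda>z. F (cnj z)) has_derivative (\<lambda>h. D (cnj h))) (at z)"
    if "(F has_derivative D) (at (cnj z))" for F :: "complex \<Rightarrow> complex" and D z
    using has_derivative_compose[OF bounded_linear_imp_has_derivative[OF bounded_linear_cnj] that] .
  show ?thesis
  proof (rule helmholtzI)
    show "open (cnj -` U)"
      by (intro open_vimage open_U continuous_intros)
    show "((\<lambda>z. f (cnj z)) has_derivative (\<lambda>h. dir_deriv f (cnj h) (cnj z))) (at z)"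
      if "z \<in> cnj -` U" for z
      by (rule *[OF has_deriv]) (use that in simp)
    show "((\<lambda>z. dir_deriv f (cnj h) (cnj z)) has_derivative
        (\<lambda>k. dir_deriv (dir_deriv f (cnj h)) (cnj k) (cnj z))) (at z)" if "z \<in> cnj -` U" for z h
      by (rule *[OF has_deriv2]) (use that in simp)
    show "continuous_on (cnj -` U) (\<lambda>z. dir_deriv (dir_deriv f (cnj h)) (cnj k) (cnj z))" for h k
      by (intro continuous_on_compose2[OF cont2] continuous_intros) auto
    show "dir_deriv (dir_deriv f (cnj 1)) (cnj 1) (cnj z) + dir_deriv (dir_deriv f (cnj \<i>)) (cnj \<i>) (cnj z)
      + of_real (\<kappa>\<^sup>2) * f (cnj z) = 0" if "z \<in> cnj -` U" for z
    proof -
      have "dir_deriv (dir_deriv f (- \<i>)) (- \<i>) (cnj z) = dir_deriv (dir_deriv f \<i>) \<i> (cnj z)"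
        using that dir_deriv2_expand[of "cnj z" "- \<i>" "- \<i>"] by simp
      then show ?thesis
        using that equation[of "cnj z"] by simp
    qed
  qed
qed

section \<open>Even solutions that vanish on the real axis\<close>

lemma dir_deriv_even:
  assumes "open U" "z \<in> U" "F differentiable (at z)" "cnj z = z"
    and even: "\<And>x. x \<in> U \<Longrightarrow> F (cnj x) = F x"
  shows "dir_deriv F \<i> z = (0 :: complex)"
proof -
  have D: "(F has_derivative (\<lambda>h. dir_deriv F h z)) (at z)"
    by (rule has_dir_deriv) fact
  then have "((\<lambda>z. F (cnj z)) has_derivative (\<lambda>h. dir_deriv F (cnj h) z)) (at z)"
    using has_derivative_compose[OF bounded_linear_imp_has_derivative[OF bounded_linear_cnj, of "at z"], of F]
      \<open>cnj z = z\<close> by simp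
  then have "(F has_derivative (\<lambda>h. dir_deriv F (cnj h) z)) (at z)"
    by (rule has_derivative_transform_within_open[OF _ assms(1,2)]) (rule even)
  from dir_derivI[OF this, of \<i>] have "dir_deriv F \<i> z = dir_deriv F (- \<i>) z"
    by simp
  also have "\<dots> = - dir_deriv F \<i> z"
    by (rule linear_neg[OF has_derivative_linear[OF D]])
  finally show ?thesis by simp
qed

lemma dir_deriv_zero_on_reals:
  assumes "open U" "z \<in> U" "F differentiable (at z)" "Im z = 0"
    and zero: "\<And>x. x \<in> U \<Longrightarrow> Im x = 0 \<Longrightarrow> F x = 0"
  shows "dir_deriv F 1 z = (0 :: complex)"
proof -
  have c: "((\<lambda>t. z + of_real t) has_vector_derivative 1) (at 0)"
    by (auto intro!: derivative_eq_intros simp: has_vector_derivative_def scaleR_conv_of_real)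
  have "((\<lambda>t. F (z + of_real t)) has_vector_derivative dir_deriv F 1 z) (at 0)"
    by (rule has_vector_derivative_compose_has_derivative[OF c]) (simp add: has_dir_deriv assms(3))
  then have "((\<lambda>t. 0) has_vector_derivative dir_deriv F 1 z) (at 0)"
  proof (rule has_vector_derivative_transform_within_open)
    show "open ((\<lambda>t. z + of_real t) -` U)"
      by (intro open_vimage assms continuous_intros)
  qed (use assms in auto)
  then show ?thesis
    by (rule vector_derivative_unique_at) (rule has_vector_derivative_const)
qed

text \<open>Made for the junction on the axis: the extension by zero is dominated by the function
  itself, which vanishes there to first order.\<close>

lemma has_derivative_zero_dominated:
  assumes "(F has_derivative (\<lambda>_. 0)) (at z)" "F z = 0" "\<And>x. norm (G x) \<le> norm (F x)"
  shows "(G has_derivative (\<lambda>_. 0)) (at z)"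
  unfolding has_derivative_at_alt
proof (intro conjI allI impI)
  fix e :: real assume "e > 0"
  then obtain d where "d > 0" "\<And>y. norm (y - z) < d \<Longrightarrow> norm (F y - F z - 0) \<le> e * norm (y - z)"
    using assms(1) unfolding has_derivative_at_alt by blast
  moreover have "G z = 0"
    using assms(2) assms(3)[of z] by simp
  ultimately show "\<exists>d>0. \<forall>y. norm (y - z) < d \<longrightarrow> norm (G y - G z - 0) \<le> e * norm (y - z)"
    using assms(2,3) order_trans by (metis diff_zero)
qed simp

text \<open>All derivatives up to order two vanish on the axis, so cutting off at the axis gives a
  C^2 solution. Combined with unique continuation this yields uniqueness for the Cauchy
  problem.\<close>

lemma helmholtz_zero_extension:
  assumes g: "helmholtz \<kappa> U g" and sym: "\<And>z. z \<in> U \<Longrightarrow> cnj z \<in> U"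
    and even: "\<And>z. z \<in> U \<Longrightarrow> g (cnj z) = g z"
    and zero: "\<And>z. z \<in> U \<Longrightarrow> Im z = 0 \<Longrightarrow> g z = 0"
  shows "helmholtz \<kappa> U (\<lambda>z. if Im z > 0 then g z else 0)"
proof -
  interpret helmholtz_on \<kappa> U g by standard fact
  have diff: "g differentiable (at z)" "dir_deriv g h differentiable (at z)" if "z \<in> U" for z h
    using that g by (auto simp: helmholtz_def)
  have even1: "dir_deriv g 1 (cnj z) = dir_deriv g 1 z" if "z \<in> U" for z
  proof -
    have "((\<lambda>z. g (cnj z)) has_derivative (\<lambda>h. dir_deriv g (cnj h) (cnj z))) (at z)"
      using has_derivative_compose[OF bounded_linear_imp_has_derivative[OF bounded_linear_cnj] has_deriv]
        sym[OF that] by blast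
    then have "(g has_derivative (\<lambda>h. dir_deriv g (cnj h) (cnj z))) (at z)"
      by (rule has_derivative_transform_within_open[OF _ open_U that]) (rule even)
    from dir_derivI[OF this, of 1] show ?thesis by simp
  qed
  have real: "cnj z = z" if "Im z = 0" for z
    using that by (simp add: complex_eq_iff)
  have 1: "dir_deriv g h z = 0" if "z \<in> U" "Im z = 0" for h z
  proof -
    have "dir_deriv g \<i> z = 0"
      using that by (intro dir_deriv_even[OF open_U] diff real even)
    moreover have "dir_deriv g 1 z = 0"
      using that by (intro dir_deriv_zero_on_reals[OF open_U] diff zero)
    ultimately show ?thesis
      using dir_deriv_expand[OF that(1), of h] by simp
  qed
  \<comment> \<open>Tangential derivatives of the vanishing gradient are zero, the remaining mixed
    one is zero because the tangential derivative is even, and the equation itself then forces the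
    pure normal one to be zero.\<close>
  have 2: "dir_deriv (dir_deriv g h) k z = 0" if "z \<in> U" "Im z = 0" for h k z
  proof -
    have "dir_deriv (dir_deriv g 1) \<i> z = 0"
      using that by (intro dir_deriv_even[OF open_U] diff real even1)
    moreover have d1: "dir_deriv (dir_deriv g h) 1 z = 0" for h
      using that by (intro dir_deriv_zero_on_reals[OF open_U] diff 1)
    moreover have "dir_deriv (dir_deriv g \<i>) \<i> z = 0"
      using equation[OF that(1)] zero[OF that] d1 by simp
    ultimately show ?thesis
      using dir_deriv2_expand[OF that(1), of h k] by simp
  qed
  let ?ext = "\<lambda>F z. if Im z > 0 then F z else (0::complex)"
  have opn: "open {z. Im z > 0}" "open {z. Im z < 0}"
    by (auto intro!: open_Collect_less continuous_intros)
  have ext: "(?ext F has_derivative (\<lambda>h. if Im z > 0 then D h else 0)) (at z)"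
    if F: "(F has_derivative D) (at z)" and 0: "Im z = 0 \<Longrightarrow> F z = 0 \<and> (\<forall>h. D h = 0)" for F D z
  proof -
    consider "Im z > 0" | "Im z < 0" | "Im z = 0" by linarith
    then show ?thesis
    proof cases
      case 1
      then have "(?ext F has_derivative D) (at z)"
        by (intro has_derivative_transform_within_open[OF F opn(1)]) auto
      with 1 show ?thesis by simp
    next
      case 2
      then have "(?ext F has_derivative (\<lambda>_. 0)) (at z)"
        by (intro has_derivative_transform_within_open[OF has_derivative_const opn(2)]) auto
      with 2 show ?thesis by simp
    next
      case 3
      then have D: "D = (\<lambda>_. 0)" and "F z = 0" using 0 by auto
      then have "(?ext F has_derivative (\<lambda>_. 0)) (at z)"
        by (intro has_derivative_zero_dominated[OF F[unfolded D]]) auto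
      with 3 show ?thesis by simp
    qed
  qed
  show ?thesis
  proof (rule helmholtzI[OF open_U])
    show "(?ext g has_derivative (\<lambda>h. ?ext (dir_deriv g h) z)) (at z)" if "z \<in> U" for z
      by (rule ext[OF has_deriv]) (use that zero 1 in auto)
    show "(?ext (dir_deriv g h) has_derivative (\<lambda>k. ?ext (dir_deriv (dir_deriv g h) k) z)) (at z)"
      if "z \<in> U" for z h
      by (rule ext[OF has_deriv2]) (use that 1 2 in auto)
    show "continuous_on U (?ext (dir_deriv (dir_deriv g h) k))" for h k
    proof -
      have "continuous_on ((U \<inter> {z. Im z \<ge> 0}) \<union> (U \<inter> {z. Im z \<le> 0})) (?ext (dir_deriv (dir_deriv g h) k))"
      proof (rule continuous_on_cases_local)
        have U: "U \<inter> {z. Im z \<ge> 0} \<union> U \<inter> {z. Im z \<le> 0} = U" by auto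
        show "closedin (top_of_set (U \<inter> {z. Im z \<ge> 0} \<union> U \<inter> {z. Im z \<le> 0})) (U \<inter> {z. Im z \<ge> 0})"
          "closedin (top_of_set (U \<inter> {z. Im z \<ge> 0} \<union> U \<inter> {z. Im z \<le> 0})) (U \<inter> {z. Im z \<le> 0})"
          unfolding U by (intro closedin_closed_Int closed_Collect_le continuous_intros)+
        show "continuous_on (U \<inter> {z. Im z \<ge> 0}) (dir_deriv (dir_deriv g h) k)"
          by (rule continuous_on_subset[OF cont2]) auto
      qed (auto simp: 2)
      moreover have "U \<inter> {z. Im z \<ge> 0} \<union> U \<inter> {z. Im z \<le> 0} = U" by auto
      ultimately show ?thesis by simp
    qed
    show "?ext (dir_deriv (dir_deriv g 1) 1) z + ?ext (dir_deriv (dir_deriv g \<i>) \<i>) z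
      + of_real (\<kappa>\<^sup>2) * ?ext g z = 0" if "z \<in> U" for z
      using equation[OF that] by simp
  qed
qed

subsection \<open>Growth and recentering of radiating solutions\<close>

text \<open>Compares the radial directions at z seen from 0 and from b. The shift by b and the
  change in length each contribute norm b / norm z.\<close>

lemma norm_sgn_diff_le:
  fixes z b :: "'a::real_normed_vector"
  assumes "z \<noteq> 0"
  shows "norm (sgn z - sgn (z - b)) \<le> 2 * norm b / norm z"
proof (cases "z = b")
  case True
  then show ?thesis using assms by (simp add: norm_sgn)
next
  case False
  have "sgn z - sgn (z - b) = (1 / norm z) *\<^sub>R b + (1 / norm z - 1 / norm (z - b)) *\<^sub>R (z - b)"
    by (simp add: sgn_div_norm algebra_simps divide_inverse)
  also have "norm \<dots> \<le> norm b / norm z + \<bar>1 / norm z - 1 / norm (z - b)\<bar> * norm (z - b)"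
    by (rule order_trans[OF norm_triangle_ineq]) simp
  also have "\<bar>1 / norm z - 1 / norm (z - b)\<bar> * norm (z - b) = \<bar>norm (z - b) - norm z\<bar> / norm z"
  proof -
    have "1 / norm z - 1 / norm (z - b) = (norm (z - b) - norm z) / (norm z * norm (z - b))"
      using False assms by (simp add: field_simps)
    then show ?thesis
      using False assms by (simp add: abs_mult)
  qed
  also have "\<dots> \<le> norm b / norm z"
    using norm_triangle_ineq3[of "z - b" z] by (intro divide_right_mono) auto
  finally show ?thesis by simp
qed

lemma uniform_limit_at_topD:
  fixes g :: "real \<Rightarrow> 'a::real_normed_vector \<Rightarrow> 'b::real_normed_vector"
  assumes "uniform_limit (sphere 0 1) g (\<lambda>_. 0) at_top" "\<epsilon> > 0"
  shows "\<exists>S. \<forall>r\<ge>S. \<forall>w. norm w = 1 \<longrightarrow> norm (g r w) < \<epsilon>"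
  using assms unfolding uniform_limit_iff eventually_at_top_linorder dist_0_norm dist_commute[of _ 0]
  by (metis mem_sphere_0)

context helmholtz_on
begin

text \<open>Along a ray, exp(-i \<kappa> s) f has as derivative the radiation expression times a
  unimodular factor. It is o(1/sqrt s), and integration gives o(sqrt r).\<close>

lemma radiating_growth:
  assumes rad: "radiating \<kappa> p f" and sub: "\<And>z. R < norm z \<Longrightarrow> z \<in> U" and "\<epsilon> > 0"
  shows "\<exists>S. \<forall>r\<ge>S. \<forall>w. norm w = 1 \<longrightarrow> norm (f (p + of_real r * w)) \<le> \<epsilon> * sqrt r"
proof -
  obtain S where S: "\<And>r w. r \<ge> S \<Longrightarrow> norm w = 1 \<Longrightarrow>
      norm (of_real (sqrt r) * (dir_deriv f w (p + of_real r * w) - \<i> * of_real \<kappa> * f (p + of_real r * w))) < \<epsilon> / 4"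
    using uniform_limit_at_topD[OF rad[unfolded radiating_def], of "\<epsilon> / 4"] \<open>\<epsilon> > 0\<close> by auto
  \<comment> \<open>Beyond r0 the rays from p lie in U and the radiation estimate holds; the final 1
    makes r0 positive, as needed to differentiate the square root.\<close>
  define r0 where "r0 = max S (\<bar>R\<bar> + norm p + 1)"
  have "r0 > 0" using norm_ge_zero[of p] unfolding r0_def by linarith
  have inU: "p + of_real r * w \<in> U" if "r \<ge> r0" "norm w = 1" for r w
  proof (rule sub)
    have "norm (of_real r * w) - norm p \<le> norm (of_real r * w + p)"
      by (rule norm_diff_ineq)
    with that show "R < norm (p + of_real r * w)"
      by (auto simp: norm_mult r0_def add.commute)
  qed
  have "continuous_on (sphere 0 1) (\<lambda>w. f (p + of_real r0 * w))"
    by (rule continuous_on_compose2[OF cont]) (auto intro!: continuous_intros inU)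
  then have "bounded ((\<lambda>w. f (p + of_real r0 * w)) ` sphere 0 1)"
    by (intro compact_imp_bounded compact_continuous_image) auto
  then obtain M where M: "\<And>w. norm w = 1 \<Longrightarrow> norm (f (p + of_real r0 * w)) \<le> M"
    unfolding bounded_iff by (metis image_eqI mem_sphere_0)
  have key: "norm (f (p + of_real r * w)) \<le> M + \<epsilon> / 2 * sqrt r" if "r \<ge> r0" "norm w = 1" for r w
  proof (cases "r = r0")
    case True
    then show ?thesis using M[OF that(2)] \<open>\<epsilon> > 0\<close> \<open>r0 > 0\<close> by (simp add: add_increasing2)
  next
    case False
    define F where "F s = cis (- \<kappa> * s) * f (p + of_real s * w)" for s
    define F' where "F' s = cis (- \<kappa> * s) *
      (dir_deriv f w (p + of_real s * w) - \<i> * of_real \<kappa> * f (p + of_real s * w))" for s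
    have dF: "(F has_vector_derivative F' s) (at s)" if "s \<ge> r0" for s
    proof -
      have cis: "((\<lambda>s. cis (- \<kappa> * s)) has_vector_derivative - \<i> * of_real \<kappa> * cis (- \<kappa> * s)) (at s)"
        unfolding has_vector_derivative_complex_iff by (auto intro!: derivative_eq_intros)
      have "(F has_vector_derivative cis (- \<kappa> * s) * dir_deriv f w (p + of_real s * w)
          + - \<i> * of_real \<kappa> * cis (- \<kappa> * s) * f (p + of_real s * w)) (at s)"
        unfolding F_def[abs_def]
        by (intro has_vector_derivative_mult cis radial_deriv inU that \<open>norm w = 1\<close>)
      then show ?thesis
        by (simp add: F'_def algebra_simps)
    qed
    have "norm (F r - F r0) \<le> \<epsilon> / 2 * sqrt r - \<epsilon> / 2 * sqrt r0"
    proof (rule differentiable_bound_general)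
      show "r0 < r" using False that by simp
      show "continuous_on {r0..r} F"
        by (intro continuous_at_imp_continuous_on ballI has_vector_derivative_continuous[OF dF]) auto
      show "continuous_on {r0..r} (\<lambda>s. \<epsilon> / 2 * sqrt s)"
        by (intro continuous_intros)
      fix s assume s: "r0 < s" "s < r"
      then have "s > 0" using \<open>r0 > 0\<close> by simp
      show "(F has_vector_derivative F' s) (at s)"
        using dF s by simp
      show "((\<lambda>s. \<epsilon> / 2 * sqrt s) has_vector_derivative \<epsilon> / 4 / sqrt s) (at s)"
        unfolding has_real_derivative_iff_has_vector_derivative[symmetric]
        using \<open>s > 0\<close> by (auto intro!: derivative_eq_intros simp: field_simps)
      have "sqrt s * norm (F' s) \<le> \<epsilon> / 4"
        using S[of s w] s \<open>norm w = 1\<close> \<open>s > 0\<close> by (auto simp: F'_def norm_mult r0_def)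
      then show "norm (F' s) \<le> \<epsilon> / 4 / sqrt s"
        using \<open>s > 0\<close> by (simp add: field_simps)
    qed
    moreover have "norm (F r) \<le> norm (F r0) + norm (F r - F r0)"
      using norm_triangle_sub by blast
    moreover have "0 \<le> \<epsilon> / 2 * sqrt r0"
      using \<open>\<epsilon> > 0\<close> \<open>r0 > 0\<close> by simp
    ultimately have "norm (F r) \<le> norm (F r0) + \<epsilon> / 2 * sqrt r"
      by linarith
    then show ?thesis
      using M[OF \<open>norm w = 1\<close>] by (simp add: F_def norm_mult)
  qed
  \<comment> \<open>Half of \<epsilon> was kept back to absorb the bound M on the initial
    circle.\<close>
  have "filterlim (\<lambda>r. \<epsilon> / 2 * sqrt r) at_top at_top"
    using \<open>\<epsilon> > 0\<close> by (intro filterlim_tendsto_pos_mult_at_top[OF tendsto_const] sqrt_at_top) auto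
  then have "\<forall>\<^sub>F r in at_top. M \<le> \<epsilon> / 2 * sqrt r"
    by (simp add: filterlim_at_top)
  then obtain S' where "\<And>r. r \<ge> S' \<Longrightarrow> M \<le> \<epsilon> / 2 * sqrt r"
    unfolding eventually_at_top_linorder by blast
  with key have "norm (f (p + of_real r * w)) \<le> \<epsilon> * sqrt r" if "r \<ge> max S' r0" "norm w = 1" for r w
    using that by fastforce
  then show ?thesis by blast
qed

text \<open>The radial directions from \<open>p\<close> and from \<open>0\<close> differ by \<open>O(1/r)\<close>, and the gradient is \<open>o(\<surd>r)\<close>
  because \<open>f\<close> is.\<close>

lemma radiating_recenter:
  assumes rad: "radiating \<kappa> p f" and sub: "\<And>z. R < norm z \<Longrightarrow> z \<in> U"
  shows "radiating \<kappa> 0 f"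
  unfolding radiating_def uniform_limit_iff eventually_at_top_linorder
proof (intro allI impI)
  fix \<epsilon>' :: real assume "\<epsilon>' > 0"
  \<comment> \<open>The 2 comes from sqrt r \<le> 2 sqrt s for the two radii, the other summand from
    the gradient bound times the change of direction.\<close>
  define C where "C = 2 + 32 * (1 + \<kappa>\<^sup>2) * norm p"
  define \<epsilon> where "\<epsilon> = \<epsilon>' / (2 * C)"
  have "C > 0" by (simp add: C_def add_pos_nonneg)
  then have "\<epsilon> > 0" using \<open>\<epsilon>' > 0\<close> by (simp add: \<epsilon>_def)
  obtain S1 where S1: "\<And>r w. r \<ge> S1 \<Longrightarrow> norm w = 1 \<Longrightarrow>
      norm (of_real (sqrt r) * (dir_deriv f w (p + of_real r * w) - \<i> * of_real \<kappa> * f (p + of_real r * w))) < \<epsilon>"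
    using uniform_limit_at_topD[OF rad[unfolded radiating_def] \<open>\<epsilon> > 0\<close>] by auto
  obtain S2 where S2: "\<And>r w. r \<ge> S2 \<Longrightarrow> norm w = 1 \<Longrightarrow> norm (f (p + of_real r * w)) \<le> \<epsilon> * sqrt r"
    using radiating_growth[OF rad sub \<open>\<epsilon> > 0\<close>] by blast
  define S where "S = \<bar>S1\<bar> + \<bar>S2\<bar> + \<bar>R\<bar> + 2 * norm p + 3"
  show "\<exists>N. \<forall>r\<ge>N. \<forall>w\<in>sphere 0 1. dist (of_real (sqrt r) *
      (dir_deriv f w (0 + of_real r * w) - \<i> * of_real \<kappa> * f (0 + of_real r * w))) 0 < \<epsilon>'"
  proof (intro exI[of _ S] allI impI ballI)
    fix r and w :: complex assume "S \<le> r" "w \<in> sphere 0 1"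
    define z where "z = of_real r * w"
    have "norm w = 1" using \<open>w \<in> sphere 0 1\<close> by simp
    have "r > 0" using \<open>S \<le> r\<close> norm_ge_zero[of p] unfolding S_def by linarith
    have norm_z: "norm z = r" using \<open>norm w = 1\<close> \<open>r > 0\<close> by (simp add: z_def norm_mult)
    have w: "w = sgn z" using \<open>r > 0\<close> \<open>norm w = 1\<close>
      using scaleR_one[of w] by (simp add: z_def sgn_mult sgn_of_real) (simp add: sgn_div_norm)
    \<comment> \<open>The growth bound is needed on the whole ball of radius 2 on which the gradient
      estimate rests; there the distance from p is at most 4 r.\<close>
    have far: "norm (f y) \<le> 2 * \<epsilon> * sqrt r" if "dist z y < 2" for y
    proof -
      have ny: "norm y \<ge> r - 2" "norm y \<le> r + 2"
        using that norm_z norm_triangle_ineq2[of z y] norm_triangle_ineq2[of y z]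
        by (auto simp: dist_norm norm_minus_commute)
      have b: "norm (y - p) \<ge> norm y - norm p" "norm (y - p) \<le> norm y + norm p"
        using norm_triangle_ineq2[of y p] norm_triangle_ineq4[of y p] by auto
      have "norm (y - p) \<ge> S2" "norm (y - p) > 0" "norm (y - p) \<le> 4 * r"
        using b ny \<open>S \<le> r\<close> norm_ge_zero[of p] unfolding S_def by linarith+
      then have "norm (f (p + of_real (norm (y - p)) * sgn (y - p))) \<le> \<epsilon> * sqrt (norm (y - p))"
        by (intro S2) (auto simp: norm_sgn)
      also have "\<dots> \<le> \<epsilon> * sqrt (4 * r)"
        using \<open>norm (y - p) \<le> 4 * r\<close> \<open>\<epsilon> > 0\<close> by (intro mult_left_mono) auto
      finally show ?thesis
        by (simp add: norm_mult_sgn real_sqrt_mult)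
    qed
    have grad: "norm (dir_deriv f h z) \<le> 4 * (1 + \<kappa>\<^sup>2) * (2 * \<epsilon> * sqrt r) * norm h" for h
    proof (rule gradient_bound)
      show "ball z 2 \<subseteq> U"
      proof
        fix y assume "y \<in> ball z 2"
        then have "norm y > r - 2"
          using norm_z norm_triangle_ineq2[of z y] by (simp add: dist_norm)
        then show "y \<in> U"
          using \<open>S \<le> r\<close> norm_ge_zero[of p] unfolding S_def by (intro sub) linarith
      qed
    qed (use far in auto)
    have "z \<in> U"
      using \<open>S \<le> r\<close> norm_ge_zero[of p] norm_z unfolding S_def by (intro sub) linarith
    define s where "s = norm (z - p)"
    have s: "s \<ge> r - norm p"
      using norm_triangle_ineq2[of z p] norm_z by (simp add: s_def)
    define w' where "w' = sgn (z - p)"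
    have z: "p + of_real s * w' = z"
      by (simp add: s_def w'_def norm_mult_sgn)
    have "s \<ge> S1" "4 * s \<ge> r" "s > 0"
      using s \<open>S \<le> r\<close> norm_ge_zero[of p] unfolding S_def by linarith+
    then have "norm w' = 1"
      by (auto simp: w'_def s_def norm_sgn)
    have 1: "sqrt r * norm (dir_deriv f w' z - \<i> * of_real \<kappa> * f z) \<le> 2 * \<epsilon>"
    proof -
      have "sqrt r \<le> sqrt (4 * s)" using \<open>4 * s \<ge> r\<close> by simp
      then have "sqrt r * norm (dir_deriv f w' z - \<i> * of_real \<kappa> * f z)
        \<le> 2 * (sqrt s * norm (dir_deriv f w' z - \<i> * of_real \<kappa> * f z))"
        by (subst mult.assoc[symmetric], intro mult_right_mono) (auto simp: real_sqrt_mult)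
      also have "\<dots> \<le> 2 * \<epsilon>"
        using S1[OF \<open>s \<ge> S1\<close> \<open>norm w' = 1\<close>] \<open>s > 0\<close> unfolding z by (simp add: norm_mult)
      finally show ?thesis .
    qed
    \<comment> \<open>The weight sqrt r and the gradient growth sqrt r together are compensated by
      the 1/r in the difference of directions, which leaves the factor \<epsilon>.\<close>
    have 2: "sqrt r * norm (dir_deriv f (w - w') z) \<le> 32 * (1 + \<kappa>\<^sup>2) * norm p * \<epsilon>"
    proof -
      have "norm (w - w') \<le> 2 * norm p / r"
        unfolding w w'_def using norm_sgn_diff_le[of z p] norm_z \<open>r > 0\<close> by fastforce
      then have "norm (dir_deriv f (w - w') z) \<le> 4 * (1 + \<kappa>\<^sup>2) * (2 * \<epsilon> * sqrt r) * (2 * norm p / r)"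
        using grad[of "w - w'"] \<open>\<epsilon> > 0\<close> \<open>r > 0\<close>
        by (elim order_trans, intro mult_left_mono) auto
      then have "sqrt r * norm (dir_deriv f (w - w') z)
        \<le> sqrt r * (4 * (1 + \<kappa>\<^sup>2) * (2 * \<epsilon> * sqrt r) * (2 * norm p / r))"
        using \<open>r > 0\<close> by (intro mult_left_mono) auto
      also have "\<dots> = 16 * (1 + \<kappa>\<^sup>2) * norm p * \<epsilon> * ((sqrt r)\<^sup>2 / r)"
      proof -
        have "q * (4 * a * (2 * \<epsilon> * q) * (2 * b / r)) = 16 * a * b * \<epsilon> * (q\<^sup>2 / r)" for q a b
          by (simp add: power2_eq_square)
        then show ?thesis .
      qed
      also have "\<dots> \<le> 32 * (1 + \<kappa>\<^sup>2) * norm p * \<epsilon>"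
        using \<open>r > 0\<close> \<open>\<epsilon> > 0\<close> by (simp add: mult_right_mono)
      finally show ?thesis .
    qed
    have "dir_deriv f w z = dir_deriv f w' z + dir_deriv f (w - w') z"
      using linear_add[OF linear1[OF \<open>z \<in> U\<close>], of w' "w - w'"] by simp
    then have "norm (dir_deriv f w z - \<i> * of_real \<kappa> * f z)
      \<le> norm (dir_deriv f w' z - \<i> * of_real \<kappa> * f z) + norm (dir_deriv f (w - w') z)"
      using norm_triangle_ineq[of "dir_deriv f w' z - \<i> * of_real \<kappa> * f z" "dir_deriv f (w - w') z"]
      by (simp add: algebra_simps)
    then have "sqrt r * norm (dir_deriv f w z - \<i> * of_real \<kappa> * f z) \<le> sqrt r *
      (norm (dir_deriv f w' z - \<i> * of_real \<kappa> * f z) + norm (dir_deriv f (w - w') z))"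
      using \<open>r > 0\<close> by (intro mult_left_mono) auto
    also have "\<dots> \<le> C * \<epsilon>"
      using 1 2 by (simp add: C_def algebra_simps)
    also have "\<dots> < \<epsilon>'"
      using \<open>C > 0\<close> \<open>\<epsilon>' > 0\<close> by (simp add: \<epsilon>_def)
    finally show "dist (of_real (sqrt r) *
      (dir_deriv f w (0 + of_real r * w) - \<i> * of_real \<kappa> * f (0 + of_real r * w))) 0 < \<epsilon>'"
      using \<open>r > 0\<close> by (simp add: norm_mult z_def)
  qed
qed

end

subsection \<open>Uniqueness from the imaginary part on the real axis\<close>

lemma connected_norm_greater: "connected {z :: complex. R < norm z}"
proof -
  have "{z :: complex. R < norm z} = - cball 0 R"
    by (auto simp: not_le)
  then show ?thesis
    by (simp add: connected_complement_bounded_convex)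
qed

lemma open_norm_greater: "open {z :: complex. R < norm z}"
  by (intro open_Collect_less continuous_intros)

theorem real_line_uniqueness:
  assumes "0 < \<kappa>" and f: "helmholtz \<kappa> V f" and "connected V"
    and upper: "\<And>z. Im z \<ge> 0 \<Longrightarrow> z \<in> V" and far: "\<And>z. R < norm z \<Longrightarrow> z \<in> V"
    and rad: "radiating \<kappa> p f" and real: "\<And>z. Im z = 0 \<Longrightarrow> Im (f z) = 0"
    and "z \<in> V"
  shows "f z = 0"
proof -
  interpret f: helmholtz_on \<kappa> V f by standard fact
  have rad0: "radiating \<kappa> 0 f"
    by (rule f.radiating_recenter[OF rad far])
  define R0 where "R0 = \<bar>R\<bar>"
  define D where "D = {z :: complex. R0 < norm z}"
  have D: "open D" "connected D" "D \<subseteq> V" "\<And>z. z \<in> D \<Longrightarrow> cnj z \<in> D"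
    using far by (auto simp: D_def R0_def open_norm_greater connected_norm_greater)
  define Y where "Y = V \<inter> cnj -` V"
  define w where "w z = f z + f (cnj z)" for z
  have f': "helmholtz \<kappa> (cnj -` V) (\<lambda>z. f (cnj z))"
    by (rule helmholtz_cnj[OF f])
  have "open Y"
    unfolding Y_def using f.open_U helmholtz_open[OF f'] by blast
  have w: "helmholtz \<kappa> Y w"
    unfolding w_def[abs_def] using \<open>open Y\<close>
    by (intro helmholtz_add helmholtz_subset[OF f] helmholtz_subset[OF f']) (auto simp: Y_def)
  interpret w: helmholtz_on \<kappa> Y w by standard fact
  have "D \<subseteq> Y" using D by (auto simp: Y_def)
  have Im_w: "Im (w z) = 0" if "z \<in> D" for z
  proof -
    let ?g = "\<lambda>z. complex_of_real (Im (w z))"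
    have "bounded_linear (\<lambda>z. complex_of_real (Im z))"
      by (intro bounded_linear_compose[OF bounded_linear_of_real bounded_linear_Im])
    then have g: "helmholtz \<kappa> D ?g"
      by (intro helmholtz_linear[of \<kappa> D w "\<lambda>z. of_real (Im z)"] helmholtz_subset[OF w D(1) \<open>D \<subseteq> Y\<close>])
    \<comment> \<open>This extension vanishes on the lower part of the connected set D, hence on all
      of D. The values of \<open>?g\<close> below the axis then follow by evenness.\<close>
    have "helmholtz \<kappa> D (\<lambda>z. if Im z > 0 then ?g z else 0)"
    proof (rule helmholtz_zero_extension[OF g D(4)])
      show "?g z = 0" if "Im z = 0" for z
      proof -
        have "cnj z = z" using that by (simp add: complex_eq_iff)
        then show ?thesis using real[OF that] by (simp add: w_def)
      qed
    qed (simp_all add: w_def add.commute)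
    then interpret g: helmholtz_on \<kappa> D "\<lambda>z. if Im z > 0 then ?g z else 0" by unfold_locales
    have zero: "?g z = 0" if "z \<in> D" "Im z > 0" for z
    proof -
      have "(if Im z > 0 then ?g z else 0) = 0"
      proof (rule g.unique_continuation[OF \<open>0 < \<kappa>\<close> D(2,1) order_refl])
        show "open {z. Im z < 0}"
          by (intro open_Collect_less continuous_intros)
        have "R0 < norm (- of_real (R0 + 1) * \<i>)"
          unfolding norm_mult norm_minus_cancel norm_of_real by (simp add: R0_def)
        then have "- of_real (R0 + 1) * \<i> \<in> {z. Im z < 0} \<inter> D"
          by (auto simp: D_def R0_def)
        then show "{z. Im z < 0} \<inter> D \<noteq> {}" by blast
      qed (use that in auto)
      then show ?thesis using that by simp
    qed
    consider "Im z > 0" | "Im z < 0" | "Im z = 0" by linarith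
    then show ?thesis
    proof cases
      case 1
      then show ?thesis using zero that by simp
    next
      case 2
      then have "?g (cnj z) = 0" using that D(4) by (intro zero) auto
      then have "Im (w (cnj z)) = 0" by simp
      then show ?thesis by (simp add: w_def add.commute)
    next
      case 3
      then have "cnj z = z" by (simp add: complex_eq_iff)
      then show ?thesis using real[OF 3] by (simp add: w_def)
    qed
  qed
  have Im_dw: "Im (dir_deriv w h z) = 0" if "z \<in> D" for h z
  proof -
    have "((\<lambda>z. Im (w z)) has_derivative (\<lambda>h. Im (dir_deriv w h z))) (at z)"
      by (intro has_derivative_Im w.has_deriv) (use that \<open>D \<subseteq> Y\<close> in auto)
    moreover have "((\<lambda>z. Im (w z)) has_derivative (\<lambda>h. 0)) (at z)"
      by (rule has_derivative_transform_within_open[OF has_derivative_const D(1) that]) (simp add: Im_w)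
    ultimately show ?thesis
      by (metis has_derivative_unique)
  qed
  have dw: "dir_deriv w h z = dir_deriv f h z + dir_deriv f (cnj h) (cnj z)" if "z \<in> D" for h z
  proof -
    have "((\<lambda>z. f (cnj z)) has_derivative (\<lambda>h. dir_deriv f (cnj h) (cnj z))) (at z)"
      using that D by (intro has_derivative_compose[OF bounded_linear_imp_has_derivative[OF bounded_linear_cnj] f.has_deriv]) auto
    then have "(w has_derivative (\<lambda>h. dir_deriv f h z + dir_deriv f (cnj h) (cnj z))) (at z)"
      unfolding w_def[abs_def] using that D by (intro has_derivative_add f.has_deriv) auto
    then show ?thesis by (rule dir_derivI)
  qed
  have small: "\<exists>N. \<forall>r\<ge>N. \<forall>u\<in>sphere 0 1. sqrt r * norm (w (of_real r * u)) < \<epsilon> \<and>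
      sqrt r * norm (dir_deriv w u (of_real r * u)) < \<epsilon>" if "\<epsilon> > 0" for \<epsilon>
  proof -
    \<comment> \<open>The combination for w is a sum of two radiation terms, at u and at its
      conjugate, so it is below 2 d, which is at most \<epsilon> and at most \<kappa>
      \<epsilon>.\<close>
    define d where "d = min \<epsilon> (\<epsilon> * \<kappa>) / 2"
    have "d > 0" using that \<open>0 < \<kappa>\<close> by (simp add: d_def)
    obtain S where S: "\<And>r u. r \<ge> S \<Longrightarrow> norm u = 1 \<Longrightarrow>
        norm (of_real (sqrt r) * (dir_deriv f u (0 + of_real r * u) - \<i> * of_real \<kappa> * f (0 + of_real r * u))) < d"
      using uniform_limit_at_topD[OF rad0[unfolded radiating_def] \<open>d > 0\<close>] by auto
    have "sqrt r * norm (w (of_real r * u)) < \<epsilon> \<and> sqrt r * norm (dir_deriv w u (of_real r * u)) < \<epsilon>"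
      if "r \<ge> max S (R0 + 1)" "norm u = 1" for r u
    proof -
      have "r > 0" using that by (auto simp: R0_def)
      let ?z = "of_real r * u"
      have "?z \<in> D" using that \<open>r > 0\<close> by (simp add: D_def norm_mult)
      have eq: "dir_deriv w u ?z - \<i> * of_real \<kappa> * w ?z
          = (dir_deriv f u ?z - \<i> * of_real \<kappa> * f ?z)
            + (dir_deriv f (cnj u) (of_real r * cnj u) - \<i> * of_real \<kappa> * f (of_real r * cnj u))"
        unfolding dw[OF \<open>?z \<in> D\<close>] w_def by (simp add: algebra_simps)
      have "sqrt r * norm (dir_deriv w u ?z - \<i> * of_real \<kappa> * w ?z)
          \<le> sqrt r * norm (dir_deriv f u ?z - \<i> * of_real \<kappa> * f ?z)
            + sqrt r * norm (dir_deriv f (cnj u) (of_real r * cnj u) - \<i> * of_real \<kappa> * f (of_real r * cnj u))"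
        unfolding eq distrib_left[symmetric] using \<open>r > 0\<close> by (intro mult_left_mono norm_triangle_ineq) auto
      also have "\<dots> < 2 * d"
        using S[of r u] S[of r "cnj u"] that \<open>r > 0\<close> by (simp add: norm_mult)
      finally have *: "sqrt r * norm (dir_deriv w u ?z - \<i> * of_real \<kappa> * w ?z) < 2 * d" .
      \<comment> \<open>Since w and its derivatives are real on D, the radiation expression has the
        radial derivative as real part and -\<kappa> w as imaginary part, so each is bounded by its
        norm.\<close>
      have Re: "dir_deriv w u ?z = of_real (Re (dir_deriv w u ?z - \<i> * of_real \<kappa> * w ?z))"
        and Im: "of_real \<kappa> * w ?z = - of_real (Im (dir_deriv w u ?z - \<i> * of_real \<kappa> * w ?z))"
        using Im_w[OF \<open>?z \<in> D\<close>] Im_dw[OF \<open>?z \<in> D\<close>, of u] by (simp_all add: complex_eq_iff)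
      have "norm (dir_deriv w u ?z) \<le> norm (dir_deriv w u ?z - \<i> * of_real \<kappa> * w ?z)"
        by (subst Re) (simp only: norm_of_real abs_Re_le_cmod)
      then have "sqrt r * norm (dir_deriv w u ?z) \<le> sqrt r * norm (dir_deriv w u ?z - \<i> * of_real \<kappa> * w ?z)"
        using \<open>r > 0\<close> by (intro mult_left_mono) auto
      with * have 1: "sqrt r * norm (dir_deriv w u ?z) < \<epsilon>"
        by (simp add: d_def)
      have "norm (of_real \<kappa> * w ?z) \<le> norm (dir_deriv w u ?z - \<i> * of_real \<kappa> * w ?z)"
        by (subst Im) (simp only: norm_minus_cancel norm_of_real abs_Im_le_cmod)
      then have "sqrt r * norm (of_real \<kappa> * w ?z) \<le> sqrt r * norm (dir_deriv w u ?z - \<i> * of_real \<kappa> * w ?z)"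
        using \<open>r > 0\<close> by (intro mult_left_mono) auto
      moreover have "sqrt r * norm (of_real \<kappa> * w ?z) = \<kappa> * (sqrt r * norm (w ?z))"
        using \<open>0 < \<kappa>\<close> by (simp add: norm_mult)
      moreover have "2 * d \<le> \<kappa> * \<epsilon>"
        by (simp add: d_def mult.commute)
      ultimately have "\<kappa> * (sqrt r * norm (w ?z)) < \<kappa> * \<epsilon>"
        using * by linarith
      then have 2: "sqrt r * norm (w ?z) < \<epsilon>"
        using \<open>0 < \<kappa>\<close> by simp
      from 1 2 show ?thesis by blast
    qed
    then show ?thesis by (intro exI[of _ "max S (R0 + 1)"]) auto
  qed
  have small': "\<exists>N. \<forall>r\<ge>N. \<forall>u\<in>sphere 0 1. dist (of_real (sqrt r) * w (of_real r * u)) 0 < \<epsilon> \<and>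
      dist (of_real (sqrt r) * dir_deriv w u (of_real r * u)) 0 < \<epsilon>" if "\<epsilon> > 0" for \<epsilon>
  proof -
    obtain N where N: "\<And>r u. r \<ge> N \<Longrightarrow> u\<in>sphere 0 1 \<Longrightarrow> sqrt r * norm (w (of_real r * u)) < \<epsilon> \<and>
      sqrt r * norm (dir_deriv w u (of_real r * u)) < \<epsilon>"
      using small[OF \<open>\<epsilon> > 0\<close>] by blast
    \<comment> \<open>The square root of a negative real is negative here, so \<open>max N 0\<close>
      is needed to pull \<open>sqrt r\<close> out of the norm.\<close>
    have "dist (of_real (sqrt r) * w (of_real r * u)) 0 < \<epsilon> \<and>
      dist (of_real (sqrt r) * dir_deriv w u (of_real r * u)) 0 < \<epsilon>"
      if "r \<ge> max N 0" "u \<in> sphere 0 1" for r u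
      using N[of r u] that by (simp add: norm_mult)
    then show ?thesis by blast
  qed
  have w0: "w z = 0" if "z \<in> D" for z
  proof (rule w.rellich[OF \<open>0 < \<kappa>\<close>])
    show "0 \<le> R0" "R0 < norm z" using that by (auto simp: D_def R0_def)
    show "z \<in> Y" if "R0 < norm z" for z
      using that \<open>D \<subseteq> Y\<close> by (auto simp: D_def)
    show "uniform_limit (sphere 0 1) (\<lambda>r u. of_real (sqrt r) * w (of_real r * u)) (\<lambda>_. 0) at_top"
      "uniform_limit (sphere 0 1) (\<lambda>r u. of_real (sqrt r) * dir_deriv w u (of_real r * u)) (\<lambda>_. 0) at_top"
      unfolding uniform_limit_iff eventually_at_top_linorder using small' by blast+
  qed
  \<comment> \<open>The whole real axis lies in this component, so it meets D, where w is already
    known to vanish.\<close>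
  define C where "C = connected_component_set Y 0"
  have C: "connected C" "open C" "C \<subseteq> Y"
    by (auto simp: C_def connected_component_subset open_connected_component \<open>open Y\<close>)
  have reals: "z \<in> C" if "Im z = 0" for z
  proof -
    have "connected {z. Im z = 0}"
    proof (rule convex_connected)
      show "convex {z. Im z = 0}"
        using convex_hyperplane[of \<i> 0] by (simp add: inner_complex_def)
    qed
    moreover have "{z. Im z = 0} \<subseteq> Y"
      using upper by (auto simp: Y_def)
    ultimately have "{z. Im z = 0} \<subseteq> C"
      unfolding C_def by (intro connected_component_maximal) auto
    then show ?thesis using that by blast
  qed
  have wC: "w z = 0" if "z \<in> C" for z
  proof (rule w.unique_continuation[OF \<open>0 < \<kappa>\<close> C D(1)])
    have "R0 < norm (complex_of_real (R0 + 1))"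
      unfolding norm_of_real by (simp add: R0_def)
    then have "of_real (R0 + 1) \<in> D \<inter> C"
      using reals[of "of_real (R0 + 1)"] by (auto simp: D_def)
    then show "D \<inter> C \<noteq> {}" by blast
  qed (use w0 that in auto)
  define F where "F z = (if Im z \<ge> 0 then f z else - f (cnj z))" for z
  have F_eq: "F z = f z" if "w z = 0" for z
    using that by (simp add: F_def w_def add_eq_0_iff)
  \<comment> \<open>The two open half planes leave out the axis; C is an open neighbourhood of it on
    which F coincides with f, so no matching of derivatives is required.\<close>
  have "helmholtz \<kappa> (\<Union>{{z. Im z > 0}, {z. Im z < 0}, C}) F"
  proof (rule helmholtz_Union)
    fix A assume "A \<in> {{z. Im z > 0}, {z. Im z < 0}, C}"
    then consider "A = {z. Im z > 0}" | "A = {z. Im z < 0}" | "A = C" by blast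
    then show "helmholtz \<kappa> A F"
    proof cases
      case 1
      have "helmholtz \<kappa> A f"
        unfolding 1 using upper
        by (intro helmholtz_subset[OF f]) (auto intro!: open_Collect_less continuous_intros)
      then show ?thesis
        by (rule helmholtz_cong) (simp add: 1 F_def)
    next
      case 2
      have "helmholtz \<kappa> A (\<lambda>z. - f (cnj z))"
        unfolding 2 using upper
        by (intro helmholtz_linear[OF helmholtz_subset[OF f'], of _ uminus])
           (auto intro!: open_Collect_less continuous_intros bounded_linear_minus bounded_linear_ident)
      then show ?thesis
        by (rule helmholtz_cong) (simp add: 2 F_def)
    next
      case 3
      have "helmholtz \<kappa> A f"
        unfolding 3 using C by (intro helmholtz_subset[OF f]) (auto simp: Y_def)
      then show ?thesis
        by (rule helmholtz_cong) (simp add: 3 F_eq wC)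
    qed
  qed
  moreover have "\<Union>{{z. Im z > 0}, {z. Im z < 0}, C} = UNIV"
    using reals by (auto simp: not_less_iff_gr_or_eq)
  ultimately have F: "helmholtz \<kappa> UNIV F" by simp
  \<comment> \<open>Near infinity F equals f on both sides of the axis, because w vanishes on D; the
    radiation condition passes to F.\<close>
  have dF: "dir_deriv F h z = dir_deriv f h z" if "z \<in> D" for h z
    using that D(3) F_eq w0
    by (intro differentiable_cong_open(2)[OF D(1)] differentiableI[OF f.has_deriv]) auto
  have "radiating \<kappa> 0 F"
    unfolding radiating_def
  proof (rule uniform_limit_cong[THEN iffD1, OF _ _ rad0[unfolded radiating_def]])
    show "\<forall>\<^sub>F r in at_top. \<forall>u\<in>sphere 0 1.
      of_real (sqrt r) * (dir_deriv f u (0 + of_real r * u) - \<i> * of_real \<kappa> * f (0 + of_real r * u)) =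
      of_real (sqrt r) * (dir_deriv F u (0 + of_real r * u) - \<i> * of_real \<kappa> * F (0 + of_real r * u))"
      using eventually_gt_at_top[of R0]
    proof eventually_elim
      case (elim r)
      show ?case
      proof
        fix u :: complex assume "u \<in> sphere 0 1"
        then have "0 + of_real r * u \<in> D"
          using elim by (simp add: D_def R0_def norm_mult)
        then show "of_real (sqrt r) * (dir_deriv f u (0 + of_real r * u) - \<i> * of_real \<kappa> * f (0 + of_real r * u)) =
          of_real (sqrt r) * (dir_deriv F u (0 + of_real r * u) - \<i> * of_real \<kappa> * F (0 + of_real r * u))"
          by (simp only: dF F_eq w0)
      qed
    qed
  qed simp
  then have F0: "F z = 0" if "z \<noteq> 0" for z
    using entire_radiating_eq_0[OF F \<open>0 < \<kappa>\<close>] that by blast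
  show ?thesis
  proof (rule f.unique_continuation[OF \<open>0 < \<kappa>\<close> \<open>connected V\<close> f.open_U order_refl])
    show "open {z. Im z > 0}"
      by (intro open_Collect_less continuous_intros)
    have "\<i> \<in> {z. Im z > 0} \<inter> V" using upper by simp
    then show "{z. Im z > 0} \<inter> V \<noteq> {}" by blast
    show "f z = 0" if "z \<in> {z. Im z > 0} \<inter> V" for z
    proof -
      have "z \<noteq> 0" using that by auto
      then show ?thesis using F0[of z] that by (simp add: F_def)
    qed
  qed fact
qed

subsection \<open>Transfer to the plane\<close>

lemma vector_of_2: "vector [x $ 1, x $ 2] = (x :: real^2)"
  by (simp add: vec_eq_iff forall_2)

lemma vector_add_axis:
  "vector [a, b] + t *\<^sub>R axis 1 1 = (vector [a + t, b] :: real^2)"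
  "vector [a, b] + t *\<^sub>R axis 2 1 = (vector [a, b + t] :: real^2)"
  by (simp_all add: vec_eq_iff forall_2 axis_def)

text \<open>Bridges the two notions of regularity: \<open>Ck_on\<close> speaks of partial
  derivatives only, and their continuity yields Frechet differentiability.\<close>

lemma has_derivative_of_partials:
  fixes F :: "real^2 \<Rightarrow> complex"
  assumes "open U" "x \<in> U"
    and diff: "\<And>i y. y \<in> U \<Longrightarrow> (\<lambda>t. F (y + t *\<^sub>R axis i 1)) differentiable (at (0::real))"
    and cont: "\<And>i. continuous_on U (partial_deriv i F)"
  shows "(F has_derivative (\<lambda>h. \<Sum>i\<in>UNIV. of_real (h $ i) * partial_deriv i F x)) (at x)"
proof -
  let ?v = "\<lambda>a b. vector [a, b] :: real^2"
  define G where "G a b = F (?v a b)" for a b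
  have v_lin: "bounded_linear (\<lambda>p. ?v (fst p) (snd p))"
  proof -
    have "linear (\<lambda>p. ?v (fst p) (snd p))"
      by (rule linearI) (simp_all add: vec_eq_iff forall_2)
    then show ?thesis by (simp add: linear_conv_bounded_linear)
  qed
  have part: "((\<lambda>t. F (y + t *\<^sub>R axis i 1)) has_vector_derivative partial_deriv i F y) (at 0)"
    if "y \<in> U" for y i
    unfolding partial_deriv_def using diff[OF that] by (simp add: vector_derivative_works)
  have shift: "((\<lambda>t. g (t - a)) has_vector_derivative D) (at a)"
    if "(g has_vector_derivative D) (at 0)" for g :: "real \<Rightarrow> complex" and D a
  proof -
    have "((\<lambda>t. t - a) has_vector_derivative 1) (at a)"
      by (auto intro!: derivative_eq_intros)
    from vector_diff_chain_at[OF this, of g D] that show ?thesis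
      by (simp add: o_def)
  qed
  have G1: "((\<lambda>a. G a b) has_vector_derivative partial_deriv 1 F (?v a b)) (at a)" if "?v a b \<in> U" for a b
    using shift[OF part[OF that, of 1], of a] by (simp add: G_def vector_add_axis)
  have G2: "((\<lambda>b. G a b) has_vector_derivative partial_deriv 2 F (?v a b)) (at b)" if "?v a b \<in> U" for a b
    using shift[OF part[OF that, of 2], of b] by (simp add: G_def vector_add_axis)
  have "open ((\<lambda>p. ?v (fst p) (snd p)) -` U)"
    by (intro open_vimage \<open>open U\<close> linear_continuous_on v_lin)
  moreover have "(x $ 1, x $ 2) \<in> (\<lambda>p. ?v (fst p) (snd p)) -` U"
    using \<open>x \<in> U\<close> by (simp add: vector_of_2)
  ultimately obtain A B where AB: "open A" "open B" "(x $ 1, x $ 2) \<in> A \<times> B"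
      "A \<times> B \<subseteq> (\<lambda>p. ?v (fst p) (snd p)) -` U"
    by (rule open_prod_elim)
  then have "x $ 2 \<in> B" by simp
  with \<open>open B\<close> obtain e where e: "e > 0" "ball (x $ 2) e \<subseteq> B"
    by (rule openE)
  \<comment> \<open>The criterion applied below asks for a convex set in the second variable, so B
    is shrunk to a ball.\<close>
  define B' where "B' = ball (x $ 2) e"
  have AB': "open A" "open B'" "convex B'" "x $ 1 \<in> A" "x $ 2 \<in> B'"
    using AB e by (auto simp: B'_def)
  have inU: "?v a b \<in> U" if "a \<in> A" "b \<in> B'" for a b
    using subsetD[OF AB(4), of "(a, b)"] e(2) that by (auto simp: B'_def)
  have "((\<lambda>(a, b). G a b) has_derivative (\<lambda>(s, t). s *\<^sub>R partial_deriv 1 F x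
      + blinfun_scaleR_left (partial_deriv 2 F (?v (x $ 1) (x $ 2))) t)) (at (x $ 1, x $ 2) within A \<times> B')"
  proof (rule has_derivative_partialsI[where fy="\<lambda>a b. blinfun_scaleR_left (partial_deriv 2 F (?v a b))"])
    show "((\<lambda>a. G a (x $ 2)) has_derivative (\<lambda>s. s *\<^sub>R partial_deriv 1 F x)) (at (x $ 1) within A)"
      using G1[of "x $ 1" "x $ 2"] \<open>x \<in> U\<close>
      by (simp add: vector_of_2 has_vector_derivative_def has_derivative_at_withinI)
    show "((\<lambda>b. G a b) has_derivative blinfun_apply (blinfun_scaleR_left (partial_deriv 2 F (?v a b)))) (at b within B')"
      if "a \<in> A" "b \<in> B'" for a b
      using G2[OF inU[OF that]] by (simp add: has_vector_derivative_def has_derivative_at_withinI)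
    have "continuous_on (A \<times> B') (\<lambda>p. blinfun_scaleR_left (partial_deriv 2 F (?v (fst p) (snd p))))"
      by (intro bounded_linear.continuous_on[OF bounded_linear_blinfun_scaleR_left]
          continuous_on_compose2[OF cont linear_continuous_on[OF v_lin]]) (use inU in auto)
    then show "continuous (at (x $ 1, x $ 2) within A \<times> B')
        (\<lambda>(a, b). blinfun_scaleR_left (partial_deriv 2 F (?v a b)))"
      using AB' by (simp add: continuous_on_eq_continuous_within case_prod_unfold)
  qed (use AB' in auto)
  moreover have "at (x $ 1, x $ 2) within A \<times> B' = at (x $ 1, x $ 2)"
    using AB' by (intro at_within_open) (auto intro: open_Times)
  ultimately have main: "((\<lambda>(a, b). G a b) has_derivative (\<lambda>(s, t). s *\<^sub>R partial_deriv 1 F x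
      + t *\<^sub>R partial_deriv 2 F x)) (at (x $ 1, x $ 2))"
    by (simp add: vector_of_2)
  have "((\<lambda>y. (y $ 1, y $ 2)) has_derivative (\<lambda>h. (h $ 1, h $ 2))) (at x)"
    by (intro has_derivative_Pair bounded_linear_imp_has_derivative bounded_linear_vec_nth)
  from has_derivative_compose[OF this main] show ?thesis
    by (simp add: G_def vector_of_2 sum_2 scaleR_conv_of_real)
qed

text \<open>The isometry hypothesis is orthonormality of the rows of the matrix of A, the form in
  which the double sum of second derivatives collapses to the Laplacian. Orientation does not enter,
  so A may be a reflection.\<close>

lemma helmholtz_isometric_pullback:
  fixes \<psi> :: "real^2 \<Rightarrow> complex" and A :: "complex \<Rightarrow> real^2"
  assumes "open U" and C2: "Ck_on 2 \<psi> U"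
    and pde: "\<And>x. x \<in> U \<Longrightarrow> laplacian \<psi> x + of_real (\<kappa>\<^sup>2) * \<psi> x = 0"
    and A: "linear A" and isometry: "\<And>i j. A 1 $ i * A 1 $ j + A \<i> $ i * A \<i> $ j = (if i = j then 1 else 0)"
  shows "helmholtz \<kappa> ((\<lambda>z. x0 + A z) -` U) (\<lambda>z. \<psi> (x0 + A z))"
proof -
  let ?E = "\<lambda>z. x0 + A z"
  have C: "continuous_on U (partial_deriv i \<psi>)" "continuous_on U (partial_deriv j (partial_deriv i \<psi>))"
    "y \<in> U \<Longrightarrow> (\<lambda>t. \<psi> (y + t *\<^sub>R axis i 1)) differentiable (at (0::real))"
    "y \<in> U \<Longrightarrow> (\<lambda>t. partial_deriv i \<psi> (y + t *\<^sub>R axis j 1)) differentiable (at (0::real))" for i j y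
    using C2 by (simp_all add: numeral_2_eq_2)
  have E: "(?E has_derivative A) (at z)" for z
    using has_derivative_add[OF has_derivative_const linear_imp_has_derivative[OF A]] by simp
  have contE: "continuous_on S ?E" for S
    by (intro continuous_on_add continuous_on_const linear_continuous_on) (use A in \<open>simp add: linear_conv_bounded_linear\<close>)
  have D: "((\<lambda>z. F (?E z)) has_derivative (\<lambda>h. \<Sum>i\<in>UNIV. of_real (A h $ i) * partial_deriv i F (?E x))) (at x)"
    if "?E x \<in> U" "\<And>i y. y \<in> U \<Longrightarrow> (\<lambda>t. F (y + t *\<^sub>R axis i 1)) differentiable (at (0::real))"
      "\<And>i. continuous_on U (partial_deriv i F)" for F x
    by (rule has_derivative_compose[OF E has_derivative_of_partials[OF \<open>open U\<close> that]])
  show "helmholtz \<kappa> (?E -` U) (\<lambda>z. \<psi> (?E z))"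
  proof (rule helmholtzI)
    show "open (?E -` U)"
      by (intro open_vimage \<open>open U\<close> contE)
    show "((\<lambda>z. \<psi> (?E z)) has_derivative
       (\<lambda>h. \<Sum>i\<in>UNIV. of_real (A h $ i) * partial_deriv i \<psi> (?E z))) (at z)" if "z \<in> ?E -` U" for z
      by (rule D) (use that C in auto)
    show "((\<lambda>z. \<Sum>i\<in>UNIV. of_real (A h $ i) * partial_deriv i \<psi> (?E z)) has_derivative
       (\<lambda>k. \<Sum>i\<in>UNIV. of_real (A h $ i) *
         (\<Sum>j\<in>UNIV. of_real (A k $ j) * partial_deriv j (partial_deriv i \<psi>) (?E z)))) (at z)"
      if "z \<in> ?E -` U" for z h
      by (intro has_derivative_sum has_derivative_mult_right D) (use that C in auto)
    show "continuous_on (?E -` U) (\<lambda>z. \<Sum>i\<in>UNIV. of_real (A h $ i) *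
         (\<Sum>j\<in>UNIV. of_real (A k $ j) * partial_deriv j (partial_deriv i \<psi>) (?E z)))" for h k
      by (intro continuous_intros continuous_on_compose2[OF C(2) contE]) auto
    show "(\<Sum>i\<in>UNIV. of_real (A 1 $ i) *
         (\<Sum>j\<in>UNIV. of_real (A 1 $ j) * partial_deriv j (partial_deriv i \<psi>) (?E z))) +
       (\<Sum>i\<in>UNIV. of_real (A \<i> $ i) *
         (\<Sum>j\<in>UNIV. of_real (A \<i> $ j) * partial_deriv j (partial_deriv i \<psi>) (?E z))) +
       of_real (\<kappa>\<^sup>2) * \<psi> (?E z) = 0" if "z \<in> ?E -` U" for z
    proof -
      let ?p = "\<lambda>i j. partial_deriv j (partial_deriv i \<psi>) (?E z)"
      have "(\<Sum>i\<in>UNIV. of_real (A 1 $ i) * (\<Sum>j\<in>UNIV. of_real (A 1 $ j) * ?p i j)) +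
         (\<Sum>i\<in>UNIV. of_real (A \<i> $ i) * (\<Sum>j\<in>UNIV. of_real (A \<i> $ j) * ?p i j))
        = (\<Sum>i\<in>UNIV. \<Sum>j\<in>UNIV. of_real (A 1 $ i * A 1 $ j + A \<i> $ i * A \<i> $ j) * ?p i j)"
        by (simp add: sum_distrib_left sum.distrib[symmetric] algebra_simps)
      also have "\<dots> = laplacian \<psi> (?E z)"
        unfolding isometry laplacian_def by (simp add: sum_2)
      finally show ?thesis
        using pde[of "?E z"] that by simp
    qed
  qed
qed

lemma radiating_diff:
  assumes f: "helmholtz \<kappa> V f" and g: "helmholtz \<kappa> V g" and far: "\<And>z. R < norm z \<Longrightarrow> z \<in> V"
    and rad: "radiating \<kappa> p f" "radiating \<kappa> p g"
  shows "radiating \<kappa> p (\<lambda>z. f z - g z)"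
proof -
  interpret f: helmholtz_on \<kappa> V f by standard fact
  interpret g: helmholtz_on \<kappa> V g by standard fact
  have *: "uniform_limit (sphere 0 1) (\<lambda>r w.
      of_real (sqrt r) * (dir_deriv f w (p + of_real r * w) - \<i> * of_real \<kappa> * f (p + of_real r * w))
      - of_real (sqrt r) * (dir_deriv g w (p + of_real r * w) - \<i> * of_real \<kappa> * g (p + of_real r * w)))
      (\<lambda>_. 0 - 0) at_top"
    using rad unfolding radiating_def by (rule uniform_limit_minus)
  show ?thesis
    unfolding radiating_def
  proof (rule uniform_limit_cong[THEN iffD1, OF _ _ *])
    show "\<forall>\<^sub>F r in at_top. \<forall>w\<in>sphere 0 1.
      of_real (sqrt r) * (dir_deriv f w (p + of_real r * w) - \<i> * of_real \<kappa> * f (p + of_real r * w))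
      - of_real (sqrt r) * (dir_deriv g w (p + of_real r * w) - \<i> * of_real \<kappa> * g (p + of_real r * w))
      = of_real (sqrt r) * (dir_deriv (\<lambda>z. f z - g z) w (p + of_real r * w)
        - \<i> * of_real \<kappa> * (f (p + of_real r * w) - g (p + of_real r * w)))"
      using eventually_gt_at_top[of "\<bar>R\<bar> + norm p"]
    proof eventually_elim
      case (elim r)
      show ?case
      proof
        fix w :: complex assume "w \<in> sphere 0 1"
        have "norm (of_real r * w) - norm p \<le> norm (of_real r * w + p)"
          by (rule norm_diff_ineq)
        then have z: "p + of_real r * w \<in> V"
          using elim \<open>w \<in> sphere 0 1\<close> by (intro far) (auto simp: norm_mult add.commute)
        show "of_real (sqrt r) * (dir_deriv f w (p + of_real r * w) - \<i> * of_real \<kappa> * f (p + of_real r * w))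
          - of_real (sqrt r) * (dir_deriv g w (p + of_real r * w) - \<i> * of_real \<kappa> * g (p + of_real r * w))
          = of_real (sqrt r) * (dir_deriv (\<lambda>z. f z - g z) w (p + of_real r * w)
            - \<i> * of_real \<kappa> * (f (p + of_real r * w) - g (p + of_real r * w)))"
          unfolding dir_derivI[OF has_derivative_diff[OF f.has_deriv[OF z] g.has_deriv[OF z]]]
          by (simp add: algebra_simps)
      qed
    qed
  qed simp
qed

text \<open>Rays from p are mapped by the isometry onto rays from the original origin, which matches
  the two radial derivatives.\<close>

lemma radiating_pullback:
  assumes som: "sommerfeld \<kappa> \<psi>" and h: "helmholtz \<kappa> V (\<lambda>z. \<psi> (x0 + A z))"
    and far: "\<And>z. R < norm z \<Longrightarrow> z \<in> V"
    and A: "linear A" "\<And>z. norm (A z) = norm z" and p: "x0 + A p = 0"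
  shows "radiating \<kappa> p (\<lambda>z. \<psi> (x0 + A z))"
proof -
  interpret helmholtz_on \<kappa> V "\<lambda>z. \<psi> (x0 + A z)" by standard fact
  have E: "x0 + A (p + of_real s * w) = s *\<^sub>R A w" for s w
  proof -
    have "A (p + of_real s * w) = A p + s *\<^sub>R A w"
      by (simp only: linear_add[OF A(1)] linear_scale[OF A(1)] flip: scaleR_conv_of_real)
    then show ?thesis using p by (simp add: add.assoc[symmetric])
  qed
  show ?thesis
    unfolding radiating_def uniform_limit_iff
  proof (intro allI impI)
    fix e :: real assume "e > 0"
    from som[unfolded sommerfeld_def uniform_limit_iff, rule_format, OF this]
      eventually_gt_at_top[of "\<bar>R\<bar> + norm p"]
    show "\<forall>\<^sub>F r in at_top. \<forall>w\<in>sphere 0 1. dist (of_real (sqrt r) *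
        (dir_deriv (\<lambda>z. \<psi> (x0 + A z)) w (p + of_real r * w)
          - \<i> * of_real \<kappa> * \<psi> (x0 + A (p + of_real r * w)))) 0 < e"
    proof eventually_elim
      case (elim r)
      show ?case
      proof
        fix w :: complex assume w: "w \<in> sphere 0 1"
        have "norm (of_real r * w) - norm p \<le> norm (of_real r * w + p)"
          by (rule norm_diff_ineq)
        then have z: "p + of_real r * w \<in> V"
          using elim(2) w by (intro far) (auto simp: norm_mult add.commute)
        have "((\<lambda>s. \<psi> (s *\<^sub>R A w)) has_vector_derivative
            dir_deriv (\<lambda>z. \<psi> (x0 + A z)) w (p + of_real r * w)) (at r)"
          using radial_deriv(1)[OF z] unfolding E .
        then have "vector_derivative (\<lambda>s. \<psi> (s *\<^sub>R A w)) (at r)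
            = dir_deriv (\<lambda>z. \<psi> (x0 + A z)) w (p + of_real r * w)"
          by (rule vector_derivative_at)
        with elim(1)[rule_format, of "A w"] w A(2)[of w]
        show "dist (of_real (sqrt r) *
          (dir_deriv (\<lambda>z. \<psi> (x0 + A z)) w (p + of_real r * w)
            - \<i> * of_real \<kappa> * \<psi> (x0 + A (p + of_real r * w)))) 0 < e"
          by (simp add: E)
      qed
    qed
  qed
qed

section \<open>Position of the curve relative to the line\<close>

lemma convex_unbounded_subset_outside:
  fixes H :: "'a::real_normed_vector set"
  assumes "convex H" "\<not> bounded H" "H \<inter> S = {}"
  shows "H \<subseteq> outside S"
proof
  fix x assume "x \<in> H"
  then have "H \<subseteq> connected_component_set (- S) x"
    using assms(3) by (intro connected_component_maximal convex_connected[OF assms(1)]) auto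
  then show "x \<in> outside S"
    using assms \<open>x \<in> H\<close> bounded_subset by (auto simp: outside_def)
qed

lemma not_bounded_halfspace_ge:
  fixes a :: "'a::real_inner"
  assumes "a \<noteq> 0"
  shows "\<not> bounded {x. a \<bullet> x \<ge> b}"
proof
  assume "bounded {x. a \<bullet> x \<ge> b}"
  then obtain M where M: "\<And>x. a \<bullet> x \<ge> b \<Longrightarrow> norm x \<le> M"
    unfolding bounded_iff by blast
  \<comment> \<open>Chosen so that the multiple x of a with inner product y lies in the half space
    but violates the Cauchy-Schwarz bound for vectors of norm at most M.\<close>
  define y where "y = max b (norm a * M + 1)"
  define x where "x = (y / (a \<bullet> a)) *\<^sub>R a"
  have ax: "a \<bullet> x = y"
    using assms by (simp add: x_def)
  then have "norm a * norm x \<le> norm a * M"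
    using M[of x] by (intro mult_left_mono) (auto simp: y_def)
  moreover have "a \<bullet> x \<le> norm a * norm x"
    by (rule norm_cauchy_schwarz)
  ultimately show False
    using ax by (simp add: y_def)
qed

text \<open>The normal coordinate is continuous and nonzero on the connected set S, so its sign is
  constant. The opposite closed half space is convex, unbounded and disjoint from S.\<close>

lemma halfplane_subset_outside:
  fixes J :: "'a::euclidean_space"
  assumes "J \<noteq> 0" and conn: "connected S" and off: "\<And>x. x \<in> S \<Longrightarrow> (x - x0) \<bullet> J \<noteq> 0"
  shows "\<exists>\<sigma>\<in>{1, -1 :: real}. {x. 0 \<le> (x - x0) \<bullet> (\<sigma> *\<^sub>R J)} \<subseteq> outside S"
proof -
  have "connected ((\<lambda>x. (x - x0) \<bullet> J) ` S)"
    by (intro connected_continuous_image conn continuous_intros)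
  then have "\<exists>\<sigma>\<in>{1, -1 :: real}. \<forall>x\<in>S. (x - x0) \<bullet> (\<sigma> *\<^sub>R J) < 0"
    using off unfolding connected_iff_interval
    by (auto simp: image_iff) (smt (verit))
  then obtain \<sigma> where \<sigma>: "\<sigma> \<in> {1, -1 :: real}" "\<And>x. x \<in> S \<Longrightarrow> (x - x0) \<bullet> (\<sigma> *\<^sub>R J) < 0"
    by blast
  have H: "{x. 0 \<le> (x - x0) \<bullet> (\<sigma> *\<^sub>R J)} = {x. (\<sigma> *\<^sub>R J) \<bullet> x \<ge> (\<sigma> *\<^sub>R J) \<bullet> x0}"
    by (auto simp: inner_diff_left inner_commute algebra_simps)
  have "{x. 0 \<le> (x - x0) \<bullet> (\<sigma> *\<^sub>R J)} \<subseteq> outside S"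
  proof (rule convex_unbounded_subset_outside)
    show "convex {x. 0 \<le> (x - x0) \<bullet> (\<sigma> *\<^sub>R J)}"
      unfolding H by (rule convex_halfspace_ge)
    show "\<not> bounded {x. 0 \<le> (x - x0) \<bullet> (\<sigma> *\<^sub>R J)}"
      unfolding H using \<sigma>(1) \<open>J \<noteq> 0\<close> by (intro not_bounded_halfspace_ge) auto
  qed (use \<sigma>(2) in fastforce)
  with \<sigma>(1) show ?thesis by blast
qed

theorem corollary1:
  fixes \<kappa> :: real and U :: "(real^2) set" and x0 \<theta> :: "real^2"
    and \<psi>1 \<psi>2 :: "real^2 \<Rightarrow> complex"
  assumes "\<kappa> > 0"
    and "exterior_region U"
    and "\<theta> \<in> sphere 0 1"
    and "straight_line x0 \<theta> \<subseteq> U"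
    and "radiation_solution \<kappa> U \<psi>1"
    and "radiation_solution \<kappa> U \<psi>2"
    and "\<forall>x\<in>straight_line x0 \<theta>. Im (\<psi>1 x) = Im (\<psi>2 x)"
  shows "\<forall>x\<in>U. \<psi>1 x = \<psi>2 x"
proof -
  obtain g where "regular_closed_curve g" and U: "U = outside (path_image g)"
    and "open U" "connected U"
    using assms(2) unfolding exterior_region_def by blast
  define S where "S = path_image g"
  have "path g"
    using \<open>regular_closed_curve g\<close> by (simp add: regular_closed_curve_def)
  then have S: "compact S" "connected S"
    by (auto simp: S_def compact_path_image connected_path_image)
  have \<theta>: "\<theta> $ 1 * \<theta> $ 1 + \<theta> $ 2 * \<theta> $ 2 = 1"
    using assms(3) by (simp add: norm_eq_1 inner_vec_def sum_2)
  define J0 :: "real^2" where "J0 = vector [- (\<theta> $ 2), \<theta> $ 1]"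
  have "J0 \<noteq> 0"
    using \<theta> by (auto simp: J0_def vec_eq_iff forall_2)
  \<comment> \<open>A point of the curve without normal component would lie on the line, hence
    outside the curve.\<close>
  have "(x - x0) \<bullet> J0 \<noteq> 0" if "x \<in> S" for x
  proof
    assume 0: "(x - x0) \<bullet> J0 = 0"
    have "x = x0 + ((x - x0) \<bullet> \<theta>) *\<^sub>R \<theta>"
    proof -
      have e: "(x $ 1 - x0 $ 1) * \<theta> $ 2 = (x $ 2 - x0 $ 2) * \<theta> $ 1"
        using 0 by (simp add: J0_def inner_vec_def sum_2)
      have "(x - x0) = ((x - x0) \<bullet> \<theta>) *\<^sub>R \<theta>"
        unfolding vec_eq_iff forall_2 using e \<theta>
        by (simp add: inner_vec_def sum_2) algebra
      then show ?thesis by (simp add: algebra_simps)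
    qed
    then have "x \<in> U"
      using assms(4) unfolding straight_line_def by blast
    with that show False
      unfolding U S_def[symmetric] by (simp add: outside_def)
  qed
  then obtain \<sigma> where \<sigma>: "\<sigma> \<in> {1, -1}" and half: "{x. 0 \<le> (x - x0) \<bullet> (\<sigma> *\<^sub>R J0)} \<subseteq> U"
    using halfplane_subset_outside[OF \<open>J0 \<noteq> 0\<close> S(2)] unfolding U S_def by blast
  \<comment> \<open>The normal is turned towards the free half plane, so that A maps the real axis
    onto the line and the closed upper half plane into U; B is the inverse of A.\<close>
  define J where "J = \<sigma> *\<^sub>R J0"
  define A where "A z = Re z *\<^sub>R \<theta> + Im z *\<^sub>R J" for z
  define B where "B x = Complex (x \<bullet> \<theta>) (x \<bullet> J)" for x
  have J: "J $ 1 = - \<sigma> * \<theta> $ 2" "J $ 2 = \<sigma> * \<theta> $ 1" and \<sigma>2: "\<sigma> * \<sigma> = 1"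
    using \<sigma> by (auto simp: J_def J0_def)
  have A: "linear A"
    by (rule linearI) (simp_all add: A_def algebra_simps)
  have isometry: "A 1 $ i * A 1 $ j + A \<i> $ i * A \<i> $ j = (if i = j then 1 else 0)" for i j
  proof -
    have "\<forall>i j. A 1 $ i * A 1 $ j + A \<i> $ i * A \<i> $ j = (if i = j then 1 else 0)"
      unfolding forall_2 using \<theta> \<sigma>2 by (simp add: A_def J) algebra
    then show ?thesis by blast
  qed
  have AB: "A (B x) = x" for x
    unfolding vec_eq_iff forall_2 using \<theta> \<sigma>2 by (simp add: A_def B_def J inner_vec_def sum_2) algebra
  have inner: "\<theta> \<bullet> \<theta> = 1" "J \<bullet> J = 1" "\<theta> \<bullet> J = 0" "J \<bullet> \<theta> = 0"
    using \<theta> \<sigma>2 by (simp_all add: inner_vec_def sum_2 J) algebra+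
  have BA: "B (A z) = z" for z
    by (simp add: B_def A_def inner_add_left inner complex_eq_iff)
  have norm_A: "norm (A z) = norm z" for z
    by (simp add: norm_eq_sqrt_inner A_def inner_add_left inner_add_right inner inner_complex_def)
  define V where "V = (\<lambda>z. x0 + A z) -` U"
  \<comment> \<open>Connectedness does not pass to preimages, so V is written as an image of U under
    the inverse map.\<close>
  have "V = (\<lambda>x. B (x - x0)) ` U"
  proof (intro equalityI subsetI)
    fix z assume "z \<in> V"
    then show "z \<in> (\<lambda>x. B (x - x0)) ` U"
      by (intro image_eqI[of _ _ "x0 + A z"]) (auto simp: V_def BA)
  qed (auto simp: V_def AB)
  moreover have "continuous_on U (\<lambda>x. B (x - x0))"
    unfolding B_def by (intro continuous_intros)
  ultimately have "connected V"
    using connected_continuous_image \<open>connected U\<close> by blast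
  have upper: "z \<in> V" if "0 \<le> Im z" for z
    unfolding V_def using half that
    by (auto simp: A_def J_def[symmetric] inner_add_left inner)
  have "bounded (- U)"
    unfolding U S_def[symmetric] by (rule cobounded_outside[OF compact_imp_bounded[OF S(1)]])
  then obtain R where R: "\<And>x. x \<notin> U \<Longrightarrow> norm x \<le> R"
    unfolding bounded_iff by blast
  have far: "z \<in> V" if "R + norm x0 < norm z" for z
  proof (rule ccontr)
    assume "z \<notin> V"
    then have "norm (x0 + A z) \<le> R" by (intro R) (simp add: V_def)
    with norm_diff_ineq[of "A z" x0] that show False
      by (simp add: norm_A add.commute)
  qed
  \<comment> \<open>\<open>B (- x0)\<close> is the coordinate of the original origin, the center of
    the given radiation condition.\<close>
  have sol: "helmholtz \<kappa> V (\<lambda>z. \<psi> (x0 + A z))" "radiating \<kappa> (B (- x0)) (\<lambda>z. \<psi> (x0 + A z))"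
    if "radiation_solution \<kappa> U \<psi>" for \<psi>
  proof -
    show h: "helmholtz \<kappa> V (\<lambda>z. \<psi> (x0 + A z))"
      unfolding V_def using that
      by (intro helmholtz_isometric_pullback \<open>open U\<close> A isometry) (auto simp: radiation_solution_def)
    show "radiating \<kappa> (B (- x0)) (\<lambda>z. \<psi> (x0 + A z))"
      using that by (intro radiating_pullback[OF _ h far A norm_A]) (auto simp: radiation_solution_def AB)
  qed
  define f where "f z = \<psi>1 (x0 + A z) - \<psi>2 (x0 + A z)" for z
  have "helmholtz \<kappa> V f"
    unfolding f_def[abs_def]
    using helmholtz_add[OF sol(1)[OF assms(5)] helmholtz_linear[OF sol(1)[OF assms(6)], of uminus]]
    by (simp add: bounded_linear_minus bounded_linear_ident)
  moreover have "radiating \<kappa> (B (- x0)) f"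
    unfolding f_def[abs_def] using assms(5,6) by (intro radiating_diff[OF _ _ far] sol)
  moreover have "Im (f z) = 0" if "Im z = 0" for z
  proof -
    have "x0 + A z \<in> straight_line x0 \<theta>"
      using that by (auto simp: straight_line_def A_def)
    then show ?thesis using assms(7) by (simp add: f_def)
  qed
  ultimately have zero: "f z = 0" if "z \<in> V" for z
    using real_line_uniqueness[OF assms(1) _ \<open>connected V\<close> upper far] that by blast
  show ?thesis
  proof
    fix x assume "x \<in> U"
    then have "B (x - x0) \<in> V" by (simp add: V_def AB)
    from zero[OF this] show "\<psi>1 x = \<psi>2 x" by (simp add: f_def AB)
  qed
qed

end
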